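(* Let $k\ge 2$ be an integer, let $p_1,\dots,p_\ell$ be a fixed sequence of distinct primes, and let $\varepsilon_{p_1},\dots,\varepsilon_{p_\ell}$ be a sequence of signs with $\varepsilon_{p_i}\in\{0,\pm1\}$ for $1\le i\le \ell$. For $x>0$ let $\mathcal D=\mathcal{D}(x)$ be the set of pairs $(D_1,D_2)$ of fundamental discriminants of real quadratic fields with $|D_1D_2|\le x$, and for such a pair let $\chi_1,\chi_2$ be the quadratic characters associated to $D_1,D_2$. Then, as $x\to\infty$, $$\frac{1}{|\mathcal D|}\#\{(D_1,D_2)\in\mathcal D:\ \mathrm{sgn}\,\sigma_{\chi_1,\chi_2}^{k-1}(p_i)=\varepsilon_{p_i},\ 1\le i\le \ell\}\ \longrightarrow\ \Bigg(\prod_{\substack{1\le i\le \ell\\ \varepsilon_{p_i}=0}}\frac{1}{(p_i+1)^2}\Bigg)\Bigg(\prod_{\substack{1\le i\le \ell\\ \varepsilon_{p_i}\ne0}}\frac{p_i(p_i+2)}{2(p_i+1)^2}\Bigg).$$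
   Context: For Dirichlet characters $\chi_1,\chi_2$ and an integer $k\ge2$, $\sigma_{\chi_1,\chi_2}^{k-1}(n)=\sum_{d\mid n}\chi_1(n/d)\chi_2(d)d^{k-1}$. For a fundamental discriminant $D_i$, the associated character is the Kronecker symbol $\chi_i(\cdot)=\left(\frac{D_i}{\cdot}\right)$. For a real number $t$, $\mathrm{sgn}(t)\in\{-1,0,1\}$ denotes its sign, with $\mathrm{sgn}(0)=0$. *)

theory Defs
  imports Complex_Main "HOL-Number_Theory.Number_Theory" "HOL-Computational_Algebra.Squarefree"
begin

text \<open>Includes the value 1, which is not the discriminant of a quadratic field.\<close>
definition fundamental_discriminant :: "int \<Rightarrow> bool" where
  "fundamental_discriminant D \<longleftrightarrow>
     (D mod 4 = 1 \<and> squarefree D) \<or>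
     (\<exists>m. D = 4 * m \<and> m mod 4 \<in> {2, 3} \<and> squarefree m)"

text \<open>The field of discriminant \<open>D\<close> is the quadratic field obtained by adjoining the square root
  of \<open>D\<close>; it is real exactly when \<open>D\<close> is positive.\<close>
definition real_quadratic_discriminants :: "int set" where
  "real_quadratic_discriminants = {D. fundamental_discriminant D \<and> D > 1}"

definition discriminant_pairs :: "real \<Rightarrow> (int \<times> int) set" where
  "discriminant_pairs x =
     {(D1, D2). D1 \<in> real_quadratic_discriminants \<and> D2 \<in> real_quadratic_discriminants \<and>
                \<bar>real_of_int (D1 * D2)\<bar> \<le> x}"

lemma finite_discriminant_pairs: "finite (discriminant_pairs x)"
proof (rule finite_subset)
  show "discriminant_pairs x \<subseteq> {1..\<lfloor>x\<rfloor>} \<times> {1..\<lfloor>x\<rfloor>}"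
  proof (clarify)
    fix a b assume "(a, b) \<in> discriminant_pairs x"
    then have ab: "a > 1" "b > 1" and le: "\<bar>real_of_int (a * b)\<bar> \<le> x"
      by (auto simp: discriminant_pairs_def real_quadratic_discriminants_def)
    from le have "real_of_int (a * b) \<le> x" by linarith
    then have "a * b \<le> \<lfloor>x\<rfloor>" by (simp only: le_floor_iff)
    moreover have "a * 1 \<le> a * b" "1 * b \<le> a * b"
      using ab by (simp_all add: mult_le_cancel_left1 mult_le_cancel_right1)
    ultimately have "a \<le> \<lfloor>x\<rfloor>" "b \<le> \<lfloor>x\<rfloor>" by linarith+
    then show "a \<in> {1..\<lfloor>x\<rfloor>} \<and> b \<in> {1..\<lfloor>x\<rfloor>}"
      using ab by simp
  qed
qed simp

definition kronecker_prime :: "int \<Rightarrow> int \<Rightarrow> int" where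
  "kronecker_prime a p =
     (if p = 2 then (if even a then 0 else if a mod 8 \<in> {1, 7} then 1 else -1)
      else Legendre a p)"

definition kronecker :: "int \<Rightarrow> int \<Rightarrow> int" where
  "kronecker a n =
     (if n = 0 then (if \<bar>a\<bar> = 1 then 1 else 0)
      else (if a < 0 \<and> n < 0 then -1 else 1) *
           (\<Prod>p\<in>prime_factors n. kronecker_prime a p ^ multiplicity p n))"

definition quadratic_character :: "int \<Rightarrow> nat \<Rightarrow> real" where
  "quadratic_character D n = real_of_int (kronecker D (int n))"

text \<open>The first argument is the exponent, that is \<open>k - 1\<close> for weight \<open>k\<close>.\<close>
definition twisted_sigma :: "nat \<Rightarrow> (nat \<Rightarrow> 'a) \<Rightarrow> (nat \<Rightarrow> 'a) \<Rightarrow> nat \<Rightarrow> 'a :: comm_semiring_1" where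
  "twisted_sigma r \<chi>1 \<chi>2 n = (\<Sum>d | d dvd n. \<chi>1 (n div d) * \<chi>2 d * of_nat d ^ r)"

end

theory Submission
  imports Defs "HOL-Analysis.Harmonic_Numbers"
begin

text \<open>
  For a prime \<open>q\<close> the sign of \<open>\<chi>\<^sub>1(q) + \<chi>\<^sub>2(q) q\<^sup>k\<^sup>-\<^sup>1\<close> is \<open>\<chi>\<^sub>2(q)\<close> if this is non-zero and
  \<open>\<chi>\<^sub>1(q)\<close> otherwise, so the count splits into finitely many counts with prescribed values of all
  \<open>\<chi>\<^sub>1(p\<^sub>i)\<close> and \<open>\<chi>\<^sub>2(p\<^sub>i)\<close>. Being a fundamental discriminant is a condition modulo 16 and modulo \<open>q\<^sup>2\<close>
  for each odd prime \<open>q\<close>, and the value of \<open>\<chi>(q)\<close> is a condition to the same modulus. By the Chinese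
  remainder theorem, with the trivial bound for the contribution of large \<open>q\<close>, the discriminants
  with prescribed values have a natural density which is a constant \<open>c > 0\<close> times a product of local
  weights \<open>1 / (q + 1)\<close> (value 0) and \<open>q / (2 (q + 1))\<close> (value \<open>\<plusminus> 1\<close>).

  If \<open>A\<close> and \<open>B\<close> have densities \<open>\<alpha>\<close> and \<open>\<beta>\<close>, the number of pairs in \<open>A \<times> B\<close> with product at most
  \<open>n\<close> is asymptotically \<open>\<alpha> \<beta>\<close> times the number \<open>H(n)\<close> of all pairs with product at most \<open>n\<close>: replacing
  \<open>B\<close> and then \<open>A\<close> by the set of all positive integers costs \<open>o(H(n)) + O(n)\<close>, and \<open>n = o(H(n))\<close>
  because the harmonic series diverges. In the quotient \<open>H\<close> and \<open>c\<^sup>2\<close> cancel.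
\<close>

section \<open>Natural density and pairs under a hyperbola\<close>

definition has_density :: "nat set \<Rightarrow> real \<Rightarrow> bool" where
  "has_density A \<alpha> \<longleftrightarrow> (\<lambda>n. real (card (A \<inter> {1..n})) / real n) \<longlonglongrightarrow> \<alpha>"

definition hyperbola_count :: "nat set \<Rightarrow> nat set \<Rightarrow> nat \<Rightarrow> nat" where
  "hyperbola_count A B n = card {(a, b). a \<in> A \<and> b \<in> B \<and> 0 < a \<and> 0 < b \<and> a * b \<le> n}"

text \<open>The slices of the hyperbola count have lengths \<open>n div a\<close>, most of them
  small, so a limit statement is not enough. The finitely many \<open>k\<close> below the threshold
  for \<open>\<delta>\<close> are absorbed into \<open>K\<close>, which makes the bound valid for
  every \<open>k\<close>.\<close>

lemma has_density_error:
  assumes "has_density B \<beta>" "\<delta> > 0"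
  obtains K where "K \<ge> 0" "\<And>k. \<bar>real (card (B \<inter> {1..k})) - \<beta> * real k\<bar> \<le> \<delta> * real k + K"
proof -
  let ?g = "\<lambda>k. \<bar>real (card (B \<inter> {1..k})) - \<beta> * real k\<bar>"
  from assms obtain N where N: "\<And>k. k \<ge> N \<Longrightarrow> \<bar>real (card (B \<inter> {1..k})) / real k - \<beta>\<bar> < \<delta>"
    unfolding has_density_def LIMSEQ_iff by (auto simp: dist_real_def)
  have *: "?g k \<le> \<delta> * real k + (\<Sum>i\<le>N. ?g i)" for k
  proof (cases "k \<le> N")
    case True
    then have "?g k \<le> (\<Sum>i\<le>N. ?g i)"
      by (intro member_le_sum) auto
    moreover have "\<delta> * real k \<ge> 0" using assms by simp
    ultimately show ?thesis by linarith
  next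
    case False
    then have k: "k > 0" by simp
    have "?g k = \<bar>real (card (B \<inter> {1..k})) / real k - \<beta>\<bar> * real k"
      using k by (simp add: left_diff_distrib abs_mult_pos)
    also have "\<dots> \<le> \<delta> * real k"
      using N[of k] False by (intro mult_right_mono) auto
    also have "\<dots> \<le> \<delta> * real k + (\<Sum>i\<le>N. ?g i)" by (simp add: sum_nonneg)
    finally show ?thesis .
  qed
  show ?thesis by (rule that[OF _ *]) (simp add: sum_nonneg)
qed

lemma hyperbola_count_commute: "hyperbola_count A B n = hyperbola_count B A n"
  unfolding hyperbola_count_def
  by (rule bij_betw_same_card[of prod.swap], rule bij_betwI[of _ _ _ prod.swap])
     (auto simp: mult.commute)

lemma hyperbola_count_eq:
  "hyperbola_count A B n = (\<Sum>a\<in>A \<inter> {1..n}. card (B \<inter> {1..n div a}))"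
proof -
  have "{(a, b). a \<in> A \<and> b \<in> B \<and> 0 < a \<and> 0 < b \<and> a * b \<le> n} =
        (SIGMA a:A \<inter> {1..n}. B \<inter> {1..n div a})"
  proof safe
    fix a b :: nat assume *: "0 < a" "0 < b" "a * b \<le> n"
    then show "b \<in> {1..n div a}" by (simp add: less_eq_div_iff_mult_less_eq mult.commute)
    show "a \<in> {1..n}" using * order_trans[of a "a * b" n] by simp
  qed (auto simp: less_eq_div_iff_mult_less_eq mult.commute)
  then show ?thesis by (simp add: hyperbola_count_def)
qed

text \<open>The count is the sum of \<open>n div a\<close> over \<open>a\<close> up to
  \<open>n\<close>, and \<open>n div a \<ge> n / a - 1\<close>. Summation gives at least
  \<open>n * (harm n - 1)\<close>, and the harmonic numbers are unbounded.\<close>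

lemma hyperbola_count_superlinear:
  "filterlim (\<lambda>n. real (hyperbola_count UNIV UNIV n) / real n) at_top sequentially"
proof (rule filterlim_at_top_mono)
  show "filterlim (\<lambda>n. harm n - 1 :: real) at_top sequentially"
    using filterlim_tendsto_add_at_top[OF tendsto_const[of "-1 :: real"] harm_at_top]
    by simp
  show "\<forall>\<^sub>F n in sequentially.
          harm n - 1 \<le> real (hyperbola_count UNIV UNIV n) / real n"
    using eventually_gt_at_top[of "0 :: nat"]
  proof eventually_elim
    case (elim n)
    have "real n * (harm n - 1) = (\<Sum>a\<in>{1..n}. real n / real a - 1)"
      by (simp add: harm_def sum_distrib_left sum_subtractf right_diff_distrib divide_inverse)
    also have "\<dots> \<le> (\<Sum>a\<in>{1..n}. real (n div a))"
    proof (rule sum_mono)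
      fix a assume "a \<in> {1..n}"
      then have a: "a > 0" by simp
      have "n = a * (n div a) + n mod a" by simp
      also have "\<dots> \<le> a * (n div a) + a" 
        using a by (intro add_left_mono less_imp_le mod_less_divisor)
      finally have "n \<le> a * (n div a) + a" .
      then have "real n \<le> real a * real (n div a) + real a"
        by (metis of_nat_add of_nat_le_iff of_nat_mult)
      then show "real n / real a - 1 \<le> real (n div a)"
        using a by (simp add: field_simps)
    qed
    also have "\<dots> = real (hyperbola_count UNIV UNIV n)"
      by (simp add: hyperbola_count_eq)
    finally show ?case using elim by (simp add: field_simps)
  qed
qed

text \<open>Each slice contributes an error of at most \<open>\<delta> * (n div a) + K\<close>.
  Enlarging the range of \<open>a\<close> from \<open>A\<close> to all of \<open>{1..n}\<close>
  makes the bound, and hence \<open>K\<close>, independent of \<open>A\<close>.\<close>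

lemma hyperbola_count_replace:
  assumes "has_density B \<beta>" "\<delta> > 0"
  obtains K where "K \<ge> 0" "\<And>A n. \<bar>real (hyperbola_count A B n) - \<beta> * real (hyperbola_count A UNIV n)\<bar>
    \<le> \<delta> * real (hyperbola_count UNIV UNIV n) + K * real n"
proof -
  obtain K where K: "K \<ge> 0"
    "\<And>k. \<bar>real (card (B \<inter> {1..k})) - \<beta> * real k\<bar> \<le> \<delta> * real k + K"
    using has_density_error[OF assms] by blast
  have "\<bar>real (hyperbola_count A B n) - \<beta> * real (hyperbola_count A UNIV n)\<bar>
    \<le> \<delta> * real (hyperbola_count UNIV UNIV n) + K * real n" for A n
  proof -
    have "\<bar>real (hyperbola_count A B n) - \<beta> * real (hyperbola_count A UNIV n)\<bar> =
      \<bar>\<Sum>a\<in>A \<inter> {1..n}. real (card (B \<inter> {1..n div a})) - \<beta> * real (n div a)\<bar>"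
      by (simp add: hyperbola_count_eq sum_subtractf sum_distrib_left)
    also have "\<dots> \<le> (\<Sum>a\<in>A \<inter> {1..n}. \<delta> * real (n div a) + K)"
      by (rule order_trans[OF sum_abs sum_mono]) (rule K)
    also have "\<dots> \<le> (\<Sum>a\<in>{1..n}. \<delta> * real (n div a) + K)"
      using K(1) assms(2) by (intro sum_mono2) auto
    also have "\<dots> = \<delta> * real (hyperbola_count UNIV UNIV n) + K * real n"
      by (simp add: hyperbola_count_eq sum.distrib sum_distrib_left)
    finally show ?thesis .
  qed
  with K(1) show ?thesis by (rule that)
qed

lemma hyperbola_count_asymp:
  assumes "has_density A \<alpha>" "has_density B \<beta>"
  shows "(\<lambda>n. real (hyperbola_count A B n) / real (hyperbola_count UNIV UNIV n)) \<longlonglongrightarrow> \<alpha> * \<beta>"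
proof (rule LIMSEQ_I)
  fix e :: real assume e: "e > 0"
  let ?H = "\<lambda>n. real (hyperbola_count UNIV UNIV n)"
  \<comment> \<open>The two replacements cost \<open>\<delta> * (1 + \<bar>\<beta>\<bar>)\<close>
    times the full count, and the linear error will cost one more \<open>\<delta>\<close>. This
    choice makes the total \<open>e / 2\<close>.\<close>
  define \<delta> where "\<delta> = e / (2 * (2 + \<bar>\<beta>\<bar>))"
  have \<delta>: "\<delta> > 0" "\<delta> * (2 + \<bar>\<beta>\<bar>) = e / 2" using e by (auto simp: \<delta>_def field_simps)
  obtain K where K: "K \<ge> 0" "\<And>A n. \<bar>real (hyperbola_count A B n) - \<beta> * real (hyperbola_count A UNIV n)\<bar>
    \<le> \<delta> * ?H n + K * real n"
    using hyperbola_count_replace[OF assms(2) \<delta>(1)] by blast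
  obtain L where L: "L \<ge> 0" "\<And>B n. \<bar>real (hyperbola_count B A n) - \<alpha> * real (hyperbola_count B UNIV n)\<bar>
    \<le> \<delta> * ?H n + L * real n"
    using hyperbola_count_replace[OF assms(1) \<delta>(1)] by blast
  define M where "M = K + \<bar>\<beta>\<bar> * L"
  \<comment> \<open>First \<open>B\<close> is replaced by \<open>UNIV\<close> with \<open>A\<close>
    kept, then \<open>A\<close> by \<open>UNIV\<close> after swapping the factors. The second error
    enters multiplied by \<open>\<beta>\<close>.\<close>
  have bound: "\<bar>real (hyperbola_count A B n) - \<alpha> * \<beta> * ?H n\<bar> \<le> \<delta> * (1 + \<bar>\<beta>\<bar>) * ?H n + M * real n" for n
  proof -
    have "\<bar>real (hyperbola_count A UNIV n) - \<alpha> * ?H n\<bar> \<le> \<delta> * ?H n + L * real n"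
      using L(2)[of UNIV n] by (simp add: hyperbola_count_commute[of UNIV A])
    then have "\<bar>\<beta>\<bar> * \<bar>real (hyperbola_count A UNIV n) - \<alpha> * ?H n\<bar> \<le> \<bar>\<beta>\<bar> * (\<delta> * ?H n + L * real n)"
      by (intro mult_left_mono) auto
    moreover have "\<bar>real (hyperbola_count A B n) - \<alpha> * \<beta> * ?H n\<bar> \<le>
      \<bar>real (hyperbola_count A B n) - \<beta> * real (hyperbola_count A UNIV n)\<bar> +
      \<bar>\<beta> * (real (hyperbola_count A UNIV n) - \<alpha> * ?H n)\<bar>"
      by (simp add: algebra_simps)
    ultimately show ?thesis using K(2)[of A n] unfolding abs_mult M_def
      by (simp add: algebra_simps)
  qed
  \<comment> \<open>Since the full count grows faster than \<open>n\<close>, the linear error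
    \<open>M * n\<close> is eventually below \<open>\<delta>\<close> times that count.\<close>
  have "\<forall>\<^sub>F n in sequentially. ?H n / real n > M / \<delta>"
    using hyperbola_count_superlinear unfolding filterlim_at_top_dense by blast
  then have "\<forall>\<^sub>F n in sequentially. \<bar>real (hyperbola_count A B n) / ?H n - \<alpha> * \<beta>\<bar> < e"
    using eventually_gt_at_top[of 0]
  proof eventually_elim
    case (elim n)
    have "M / \<delta> \<ge> 0" using K(1) L(1) \<delta>(1) by (simp add: M_def)
    with elim have H: "?H n > 0" by (metis divide_eq_0_iff linorder_not_less of_nat_0_le_iff order_le_less_trans order_less_le)
    have Mn: "M * real n < \<delta> * ?H n" using elim \<delta>(1) by (simp add: field_simps)
    have "\<bar>real (hyperbola_count A B n) / ?H n - \<alpha> * \<beta>\<bar> = \<bar>real (hyperbola_count A B n) - \<alpha> * \<beta> * ?H n\<bar> / ?H n"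
    proof -
      have "real (hyperbola_count A B n) / ?H n - \<alpha> * \<beta> = (real (hyperbola_count A B n) - \<alpha> * \<beta> * ?H n) / ?H n"
        using H by (simp add: diff_divide_distrib)
      then show ?thesis by (simp add: abs_divide)
    qed
    also have "\<dots> \<le> (\<delta> * (1 + \<bar>\<beta>\<bar>) * ?H n + \<delta> * ?H n) / ?H n"
      using bound[of n] Mn H by (intro divide_right_mono) auto
    also have "\<dots> = \<delta> * (2 + \<bar>\<beta>\<bar>)" using H by (simp add: field_simps)
    also have "\<dots> = e / 2" by (rule \<delta>)
    finally show ?case using e by linarith
  qed
  then show "\<exists>n0. \<forall>n\<ge>n0. norm (real (hyperbola_count A B n) / ?H n - \<alpha> * \<beta>) < e"
    by (simp add: eventually_sequentially)
qed

text \<open>The removed elements number at most \<open>card X\<close>, which vanishes after division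
  by \<open>n\<close>. This serves to discard 1, which satisfies
  \<open>fundamental_discriminant\<close> without belonging to a quadratic field.\<close>

lemma has_density_Diff_finite:
  assumes "has_density A \<alpha>" "finite X"
  shows "has_density (A - X) \<alpha>"
proof -
  have "(\<lambda>n. real (card (A \<inter> {1..n})) / real n - real (card ((A \<inter> X) \<inter> {1..n})) / real n) \<longlonglongrightarrow> \<alpha> - 0"
  proof (intro tendsto_diff)
    show "(\<lambda>n. real (card (A \<inter> X \<inter> {1..n})) / real n) \<longlonglongrightarrow> 0"
    proof (rule real_tendsto_sandwich[where f="\<lambda>_. 0" and h="\<lambda>n. real (card X) / real n"])
      show "\<forall>\<^sub>F n in sequentially. real (card (A \<inter> X \<inter> {1..n})) / real n \<le> real (card X) / real n"
        using assms(2) by (intro always_eventually allI divide_right_mono) (auto intro: card_mono)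
    qed (auto intro: lim_const_over_n)
  qed (use assms in \<open>simp add: has_density_def\<close>)
  moreover have "real (card ((A - X) \<inter> {1..n})) = real (card (A \<inter> {1..n})) - real (card ((A \<inter> X) \<inter> {1..n}))" for n
  proof -
    have "card ((A - X) \<inter> {1..n} \<union> (A \<inter> X) \<inter> {1..n}) = card ((A - X) \<inter> {1..n}) + card ((A \<inter> X) \<inter> {1..n})"
      by (rule card_Un_disjoint) auto
    moreover have "(A - X) \<inter> {1..n} \<union> (A \<inter> X) \<inter> {1..n} = A \<inter> {1..n}" by auto
    ultimately show ?thesis by simp
  qed
  ultimately show ?thesis by (simp add: has_density_def diff_divide_distrib)
qed

section \<open>Density of integers with local conditions\<close>

text \<open>Sending \<open>n\<close> to its vector of residues is a bijection from the counted set
  onto the product of the sets \<open>C i\<close>: the Chinese remainder theorem gives existence and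
  uniqueness of the preimage.\<close>

lemma card_chinese_remainder:
  fixes m :: "'a \<Rightarrow> nat"
  assumes "finite S" "\<And>i. i \<in> S \<Longrightarrow> m i > 0"
    and "\<And>i j. i \<in> S \<Longrightarrow> j \<in> S \<Longrightarrow> i \<noteq> j \<Longrightarrow> coprime (m i) (m j)"
    and "\<And>i. i \<in> S \<Longrightarrow> C i \<subseteq> {..<m i}"
  shows "card {n. n < (\<Prod>i\<in>S. m i) \<and> (\<forall>i\<in>S. n mod m i \<in> C i)} = (\<Prod>i\<in>S. card (C i))"
proof -
  let ?X = "{n. n < (\<Prod>i\<in>S. m i) \<and> (\<forall>i\<in>S. n mod m i \<in> C i)}"
  have ex1: "\<exists>!x. x < (\<Prod>i\<in>S. m i) \<and> (\<forall>i\<in>S. [x = u i] (mod m i))" for u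
    using assms by (intro chinese_remainder_unique_nat) auto
  have "bij_betw (\<lambda>n. \<lambda>i\<in>S. n mod m i) ?X (\<Pi>\<^sub>E i\<in>S. C i)"
  proof (rule bij_betw_imageI)
    show "inj_on (\<lambda>n. \<lambda>i\<in>S. n mod m i) ?X"
    proof (rule inj_onI)
      fix x y assume xy: "x \<in> ?X" "y \<in> ?X" "(\<lambda>i\<in>S. x mod m i) = (\<lambda>i\<in>S. y mod m i)"
      have "\<forall>i\<in>S. [x = y] (mod m i)"
        using xy(3) by (auto simp: cong_def fun_eq_iff restrict_def split: if_splits)
      then show "x = y" using ex1[of "\<lambda>_. y"] xy(1,2) by auto
    qed
    show "(\<lambda>n. \<lambda>i\<in>S. n mod m i) ` ?X = (\<Pi>\<^sub>E i\<in>S. C i)"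
    proof (rule Set.set_eqI, rule iffI)
      fix u assume u: "u \<in> (\<Pi>\<^sub>E i\<in>S. C i)"
      obtain x where x: "x < (\<Prod>i\<in>S. m i)" "\<forall>i\<in>S. [x = u i] (mod m i)" using ex1 by blast
      have "x mod m i = u i" if "i \<in> S" for i
        using x(2) that assms(4) u by (fastforce simp: cong_def)
      then have "(\<lambda>i\<in>S. x mod m i) = u" "x \<in> ?X"
        using u x(1) by (auto simp: fun_eq_iff restrict_def PiE_def extensional_def)
      then show "u \<in> (\<lambda>n. \<lambda>i\<in>S. n mod m i) ` ?X" by blast
    qed auto
  qed
  then show ?thesis using assms(1) by (simp add: bij_betw_same_card card_PiE)
qed

text \<open>Every full period contributes the same number \<open>c\<close>. Enclosing
  \<open>k\<close> between consecutive multiples of \<open>N\<close> bounds the deviation from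
  \<open>k * c / N\<close> independently of \<open>k\<close>.\<close>

lemma has_density_periodic:
  assumes N: "N > 0" and per: "\<And>n. P (n mod N) \<longleftrightarrow> P n"
  shows "has_density {n. P n} (real (card {n. n < N \<and> P n}) / real N)"
proof -
  define c where "c = card {n. n < N \<and> P n}"
  have cnt: "card {n. n < N * j \<and> P n} = j * c" for j
  proof (induction j)
    case (Suc j)
    have "{n. n < N * Suc j \<and> P n} = {n. n < N * j \<and> P n} \<union> (+) (N * j) ` {n. n < N \<and> P n}"
    proof (rule Set.set_eqI)
      fix n
      show "n \<in> {n. n < N * Suc j \<and> P n} \<longleftrightarrow> n \<in> {n. n < N * j \<and> P n} \<union> (+) (N * j) ` {n. n < N \<and> P n}"
      proof (cases "n < N * j")
        case False
        then obtain r where r: "n = N * j + r" by (metis le_Suc_ex not_less)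
        have "P n \<longleftrightarrow> P r" using per[of n] per[of r] by (simp add: r)
        then show ?thesis by (auto simp: r)
      qed (use N in auto)
    qed
    moreover have "{n. n < N * j \<and> P n} \<inter> (+) (N * j) ` {n. n < N \<and> P n} = {}" by auto
    ultimately have "card {n. n < N * Suc j \<and> P n} = card {n. n < N * j \<and> P n} + card ((+) (N * j) ` {n. n < N \<and> P n})"
      by (simp add: card_Un_disjoint)
    also have "card ((+) (N * j) ` {n. n < N \<and> P n}) = c"
      unfolding c_def by (rule card_image) (auto simp: inj_on_def)
    finally show ?case using Suc by simp
  qed simp
  have bound: "\<bar>real (card ({n. P n} \<inter> {1..k})) - real k * (real c / real N)\<bar> \<le> real c + 1" for k
  proof -
    define j where "j = k div N"
    have k: "N * j \<le> k" "k < N * Suc j"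
      using N dividend_less_times_div[of N k] by (auto simp: j_def mult.commute)
    \<comment> \<open>The periods start at 0 whereas the density counts from 1, so 0 may have to be
      added. This accounts for the extra 1 in the bound.\<close>
    have "card {n. n < N * j \<and> P n} \<le> card (insert 0 ({n. P n} \<inter> {1..k}))"
      using k by (intro card_mono) auto
    also have "\<dots> \<le> Suc (card ({n. P n} \<inter> {1..k}))" by (rule card_insert_le_m1) auto
    finally have lo: "j * c \<le> Suc (card ({n. P n} \<inter> {1..k}))" by (simp add: cnt)
    have "card ({n. P n} \<inter> {1..k}) \<le> card {n. n < N * Suc j \<and> P n}"
      using k by (intro card_mono) auto
    then have hi: "card ({n. P n} \<inter> {1..k}) \<le> Suc j * c" by (simp only: cnt)
    have "real N * real j \<le> real k" "real k \<le> real N * (real j + 1)"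
      using k by (metis of_nat_le_iff of_nat_mult, metis less_imp_le of_nat_Suc of_nat_le_iff of_nat_mult add.commute)
    then have "real j \<le> real k / real N" "real k / real N \<le> real j + 1"
      using N by (simp_all add: field_simps)
    then have "real j * real c \<le> real k / real N * real c" "real k / real N * real c \<le> (real j + 1) * real c"
      by (simp_all only: mult_right_mono of_nat_0_le_iff)
    moreover have "real j * real c \<le> 1 + real (card ({n. P n} \<inter> {1..k}))"
      using lo by (metis of_nat_Suc of_nat_le_iff of_nat_mult)
    moreover have "real (card ({n. P n} \<inter> {1..k})) \<le> (real j + 1) * real c"
      using hi by (metis add.commute of_nat_Suc of_nat_le_iff of_nat_mult)
    ultimately show ?thesis by (simp add: abs_le_iff algebra_simps)
  qed
  have "(\<lambda>k. real (card ({n. P n} \<inter> {1..k})) / real k - real c / real N) \<longlonglongrightarrow> 0"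
  proof (rule Lim_null_comparison)
    show "(\<lambda>k. (real c + 1) / real k) \<longlonglongrightarrow> 0" by (rule lim_const_over_n)
    show "\<forall>\<^sub>F k in sequentially. norm (real (card ({n. P n} \<inter> {1..k})) / real k - real c / real N) \<le> (real c + 1) / real k"
      using eventually_gt_at_top[of 0]
    proof eventually_elim
      case (elim k)
      then have "real (card ({n. P n} \<inter> {1..k})) / real k - real c / real N =
        (real (card ({n. P n} \<inter> {1..k})) - real k * (real c / real N)) / real k"
        by (simp add: diff_divide_distrib)
      then show ?case using bound[of k] by (simp add: abs_divide divide_right_mono)
    qed
  qed
  then show ?thesis unfolding has_density_def c_def by (rule LIM_zero_cancel)
qed

section \<open>Tail bound for integers with a large square divisor\<close>

lemma sum_inverse_squares_le:
  "z \<le> k \<Longrightarrow> 1 \<le> z \<Longrightarrow> (\<Sum>d\<in>{z<..k}. 1 / (real d)\<^sup>2) \<le> 1 / real z - 1 / real k"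
proof (induction k rule: dec_induct)
  case (step n)
  have "{z<..Suc n} = insert (Suc n) {z<..n}" using step by auto
  \<comment> \<open>Comparison with \<open>1 / (n * (n + 1))\<close> makes the sum
    telescope.\<close>
  moreover have "1 / (real (Suc n))\<^sup>2 \<le> 1 / real n - 1 / real (Suc n)"
  proof -
    have n: "n > 0" using step by simp
    have "1 / (real (Suc n))\<^sup>2 \<le> 1 / (real n * real (Suc n))"
      unfolding power2_eq_square using n by (intro divide_left_mono mult_right_mono) auto
    also have "\<dots> = 1 / real n - 1 / real (Suc n)" using n by (simp add: field_simps)
    finally show ?thesis .
  qed
  ultimately show ?case using step by simp
qed simp

text \<open>Union bound: there are \<open>k div d\<^sup>2\<close> multiples of
  \<open>d\<^sup>2\<close> up to \<open>k\<close>, and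
  \<open>d \<le> d\<^sup>2 \<le> n \<le> k\<close> confines \<open>d\<close> to
  \<open>{z<..k}\<close>. The sum of the inverse squares over this range is at most
  \<open>1 / z\<close>.\<close>

lemma card_large_square_divisor:
  assumes "z \<ge> 1"
  shows "real (card {n \<in> {1..k}. \<exists>d>z. d\<^sup>2 dvd n}) \<le> real k / real z"
proof (cases "z \<le> k")
  case True
  have "card {n \<in> {1..k}. \<exists>d>z. d\<^sup>2 dvd n} \<le> card (\<Union>d\<in>{z<..k}. (\<lambda>j. d\<^sup>2 * j) ` {1..k div d\<^sup>2})"
  proof (rule card_mono)
    show "{n \<in> {1..k}. \<exists>d>z. d\<^sup>2 dvd n} \<subseteq> (\<Union>d\<in>{z<..k}. (\<lambda>j. d\<^sup>2 * j) ` {1..k div d\<^sup>2})"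
    proof clarify
      fix n d assume *: "n \<in> {1..k}" "z < d" "d\<^sup>2 dvd n"
      then obtain j where j: "n = d\<^sup>2 * j" by blast
      have "d \<le> d\<^sup>2" by (simp add: power2_eq_square)
      also have "d\<^sup>2 \<le> n" using * by (auto intro: dvd_imp_le)
      finally have "d \<in> {z<..k}" using * by simp
      moreover have "j \<in> {1..k div d\<^sup>2}"
        using * j by (auto simp: less_eq_div_iff_mult_less_eq mult.commute)
      ultimately show "n \<in> (\<Union>d\<in>{z<..k}. (\<lambda>j. d\<^sup>2 * j) ` {1..k div d\<^sup>2})" using j by blast
    qed
  qed auto
  also have "\<dots> \<le> (\<Sum>d\<in>{z<..k}. card ((\<lambda>j. d\<^sup>2 * j) ` {1..k div d\<^sup>2}))"
    by (rule card_UN_le) simp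
  also have "\<dots> \<le> (\<Sum>d\<in>{z<..k}. k div d\<^sup>2)"
  proof (rule sum_mono)
    fix d show "card ((\<lambda>j. d\<^sup>2 * j) ` {1..k div d\<^sup>2}) \<le> k div d\<^sup>2"
      using card_image_le[of "{1..k div d\<^sup>2}" "\<lambda>j. d\<^sup>2 * j"] by simp
  qed
  finally have "real (card {n \<in> {1..k}. \<exists>d>z. d\<^sup>2 dvd n}) \<le> (\<Sum>d\<in>{z<..k}. real (k div d\<^sup>2))"
    by (simp only: of_nat_sum[symmetric] of_nat_le_iff)
  also have "\<dots> \<le> (\<Sum>d\<in>{z<..k}. real k * (1 / (real d)\<^sup>2))"
  proof (rule sum_mono)
    fix d show "real (k div d\<^sup>2) \<le> real k * (1 / (real d)\<^sup>2)"
      using of_nat_div_le_of_nat[of k "d\<^sup>2", where 'a=real] by simp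
  qed
  also have "\<dots> = real k * (\<Sum>d\<in>{z<..k}. 1 / (real d)\<^sup>2)" by (simp add: sum_distrib_left)
  also have "\<dots> \<le> real k * (1 / real z - 1 / real k)"
    by (intro mult_left_mono sum_inverse_squares_le assms True) auto
  also have "\<dots> \<le> real k / real z" by (simp add: field_simps)
  finally show ?thesis .
next
  case False
  have "\<not> d\<^sup>2 dvd n" if "n \<in> {1..k}" "d > z" for n d
  proof
    assume "d\<^sup>2 dvd n"
    then have "d\<^sup>2 \<le> n" using that by (auto intro: dvd_imp_le)
    moreover have "d \<le> d\<^sup>2" by (simp add: power2_eq_square)
    ultimately show False using that False by simp
  qed
  then have "{n \<in> {1..k}. \<exists>d>z. d\<^sup>2 dvd n} = {}" by blast
  then show ?thesis by (metis card.empty divide_nonneg_nonneg of_nat_0 of_nat_0_le_iff)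
qed

section \<open>Local conditions at the primes and their joint density\<close>

definition local_modulus :: "nat \<Rightarrow> nat" where
  "local_modulus q = (if q = 2 then 16 else q\<^sup>2)"

text \<open>At 2, the residues 1, 5, 9, 13 are those congruent to 1 modulo 4, while 8 and 12 encode
  \<open>4 * m\<close> with \<open>m\<close> congruent to 2 or 3 modulo 4. The latter is visible
  modulo 16 but not modulo 8, hence the modulus at 2. At odd \<open>q\<close> only divisibility by
  \<open>q\<^sup>2\<close> is excluded.\<close>

definition fundamental_residues :: "nat \<Rightarrow> nat set" where
  "fundamental_residues q = (if q = 2 then {1, 5, 8, 9, 12, 13} else {1..<q\<^sup>2})"

lemma local_modulus_pos: "prime q \<Longrightarrow> local_modulus q > 0"
  by (auto simp: local_modulus_def dest: prime_gt_0_nat)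

lemma coprime_local_modulus:
  assumes "prime p" "prime q" "p \<noteq> q"
  shows "coprime (local_modulus p) (local_modulus q)"
proof -
  have *: "\<exists>e. local_modulus q = q ^ e" for q
    by (cases "q = 2") (auto simp: local_modulus_def intro: exI[of _ 4] exI[of _ 2])
  obtain d e where "local_modulus p = p ^ d" "local_modulus q = q ^ e" using * by metis
  then show ?thesis using assms by (simp add: primes_coprime)
qed

lemma fundamental_residues_subset: "fundamental_residues q \<subseteq> {..<local_modulus q}"
  by (auto simp: fundamental_residues_def local_modulus_def)

lemma finite_fundamental_residues [simp]: "finite (fundamental_residues q)"
  by (simp add: fundamental_residues_def)

lemma card_fundamental_residues:
  "card (fundamental_residues q) = (if q = 2 then 6 else q\<^sup>2 - 1)"
  by (simp add: fundamental_residues_def)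

lemma finite_primes_le: "finite {q::nat. prime q \<and> q \<le> z}"
  by (rule finite_subset[of _ "{..z}"]) auto

text \<open>Finitely many conditions to coprime moduli are periodic modulo the product of the
  moduli, and the Chinese remainder theorem factors the count in one period.\<close>

lemma has_density_truncated:
  assumes "\<And>q. prime q \<Longrightarrow> C q \<subseteq> {..<local_modulus q}"
  shows "has_density {n. \<forall>q. prime q \<and> q \<le> z \<longrightarrow> n mod local_modulus q \<in> C q}
           (\<Prod>q | prime q \<and> q \<le> z. real (card (C q)) / real (local_modulus q))"
proof -
  let ?S = "{q. prime q \<and> q \<le> z}"
  let ?N = "\<Prod>q\<in>?S. local_modulus q"
  let ?P = "\<lambda>n. \<forall>q\<in>?S. n mod local_modulus q \<in> C q"
  have "has_density {n. ?P n} (real (card {n. n < ?N \<and> ?P n}) / real ?N)"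
  proof (rule has_density_periodic)
    show "?N > 0" by (auto intro!: prod_pos local_modulus_pos)
    have "local_modulus q dvd ?N" if "q \<in> ?S" for q
      using that finite_primes_le by (rule_tac dvd_prodI) auto
    then show "?P (n mod ?N) \<longleftrightarrow> ?P n" for n by (simp add: mod_mod_cancel)
  qed
  also have "card {n. n < ?N \<and> ?P n} = (\<Prod>q\<in>?S. card (C q))"
    using assms by (intro card_chinese_remainder finite_primes_le)
      (auto intro: local_modulus_pos coprime_local_modulus)
  finally show ?thesis by (simp add: prod_dividef)
qed

text \<open>An integer that meets the conditions at the primes up to \<open>z\<close> but not all of them is
  divisible by the square of a prime above \<open>z\<close>, and the proportion of such integers is at most
  \<open>1 / z\<close>.\<close>
lemma has_density_local_conditions:
  assumes C: "\<And>q. prime q \<Longrightarrow> C q \<subseteq> {..<local_modulus q}"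
    and large: "\<And>q. prime q \<Longrightarrow> q > z0 \<Longrightarrow> C q = fundamental_residues q"
    and lim: "(\<lambda>z. \<Prod>q | prime q \<and> q \<le> z. real (card (C q)) / real (local_modulus q)) \<longlonglongrightarrow> L"
  shows "has_density {n. \<forall>q. prime q \<longrightarrow> n mod local_modulus q \<in> C q} L"
  unfolding has_density_def
proof (rule LIMSEQ_I)
  fix e :: real assume e: "e > 0"
  let ?A = "{n. \<forall>q. prime q \<longrightarrow> n mod local_modulus q \<in> C q}"
  let ?B = "\<lambda>z. {n. \<forall>q. prime q \<and> q \<le> z \<longrightarrow> n mod local_modulus q \<in> C q}"
  let ?a = "\<lambda>z. \<Prod>q | prime q \<and> q \<le> z. real (card (C q)) / real (local_modulus q)"
  have "\<forall>\<^sub>F z in sequentially. \<bar>?a z - L\<bar> < e / 3"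
    using tendstoD[OF lim, of "e / 3"] e by (simp add: dist_real_def)
  moreover have "\<forall>\<^sub>F z in sequentially. 1 / real z < e / 3"
    using order_tendstoD(2)[OF lim_1_over_n, of "e / 3"] e by simp
  \<comment> \<open>One third of \<open>e\<close> each goes to truncating the product, to the
    integers lost beyond \<open>z\<close>, and to the convergence of the truncated density. The
    bound \<open>z \<ge> 2\<close> ensures that a prime above \<open>z\<close> is odd, so that its
    modulus is its square.\<close>
  ultimately have "\<forall>\<^sub>F z in sequentially. z \<ge> max 2 z0 \<and> \<bar>?a z - L\<bar> < e / 3 \<and> 1 / real z < e / 3"
    using eventually_ge_at_top[of "max 2 z0"] by eventually_elim auto
  then obtain z where z: "z \<ge> 2" "z \<ge> z0" "\<bar>?a z - L\<bar> < e / 3" "1 / real z < e / 3"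
    unfolding eventually_sequentially by auto
  have diff: "\<bar>real (card (?B z \<inter> {1..k})) - real (card (?A \<inter> {1..k}))\<bar> \<le> real k / real z" for k
  proof -
    have "?B z \<inter> {1..k} \<subseteq> ?A \<inter> {1..k} \<union> {n \<in> {1..k}. \<exists>d>z. d\<^sup>2 dvd n}"
    proof
      fix n assume n: "n \<in> ?B z \<inter> {1..k}"
      show "n \<in> ?A \<inter> {1..k} \<union> {n \<in> {1..k}. \<exists>d>z. d\<^sup>2 dvd n}"
      proof (cases "n \<in> ?A")
        case False
        then obtain q where q: "prime q" "n mod local_modulus q \<notin> C q" by auto
        from n have "\<not> q \<le> z" using q by blast
        then have "q > z" by simp
        with z q large[of q] have "n mod q\<^sup>2 \<notin> {1..<q\<^sup>2}"
          by (auto simp: local_modulus_def fundamental_residues_def)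
        moreover have "n mod q\<^sup>2 < q\<^sup>2" using q(1) by (simp add: prime_gt_0_nat)
        ultimately have "q\<^sup>2 dvd n" by (auto simp: dvd_eq_mod_eq_0)
        with n \<open>q > z\<close> show ?thesis by blast
      qed (use n in auto)
    qed
    then have "card (?B z \<inter> {1..k}) \<le> card (?A \<inter> {1..k} \<union> {n \<in> {1..k}. \<exists>d>z. d\<^sup>2 dvd n})"
      by (intro card_mono) auto
    also have "\<dots> \<le> card (?A \<inter> {1..k}) + card {n \<in> {1..k}. \<exists>d>z. d\<^sup>2 dvd n}"
      by (rule card_Un_le)
    finally have "real (card (?B z \<inter> {1..k})) \<le> real (card (?A \<inter> {1..k})) + real (card {n \<in> {1..k}. \<exists>d>z. d\<^sup>2 dvd n})"
      by linarith
    moreover have "card (?A \<inter> {1..k}) \<le> card (?B z \<inter> {1..k})"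
      by (intro card_mono) auto
    moreover have "real (card {n \<in> {1..k}. \<exists>d>z. d\<^sup>2 dvd n}) \<le> real k / real z"
      using z by (intro card_large_square_divisor) simp
    ultimately show ?thesis by linarith
  qed
  have "has_density (?B z) (?a z)" by (rule has_density_truncated[OF C])
  then have "\<forall>\<^sub>F k in sequentially. \<bar>real (card (?B z \<inter> {1..k})) / real k - ?a z\<bar> < e / 3"
    unfolding has_density_def
    by (drule_tac tendstoD[where e="e / 3"]) (use e in \<open>simp_all add: dist_real_def\<close>)
  then have "\<forall>\<^sub>F k in sequentially. \<bar>real (card (?A \<inter> {1..k})) / real k - L\<bar> < e"
    using eventually_gt_at_top[of 0]
  proof eventually_elim
    case (elim k)
    have "\<bar>real (card (?B z \<inter> {1..k})) / real k - real (card (?A \<inter> {1..k})) / real k\<bar> =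
      \<bar>real (card (?B z \<inter> {1..k})) - real (card (?A \<inter> {1..k}))\<bar> / real k"
      by (simp add: abs_divide flip: diff_divide_distrib)
    also have "\<dots> \<le> real k / real z / real k"
      by (intro divide_right_mono diff) simp
    also have "\<dots> = 1 / real z" using elim by simp
    finally show ?case using z elim by linarith
  qed
  then show "\<exists>no. \<forall>n\<ge>no. norm (real (card (?A \<inter> {1..n})) / real n - L) < e"
    by (simp add: eventually_sequentially)
qed

text \<open>All factors are at most 1, so the partial products decrease and converge. The substance
  is the positivity of the limit, which allows the division by \<open>c * c\<close> in the final
  quotient.\<close>

lemma fundamental_euler_product:
  obtains c where "c > 0"
    "(\<lambda>z. \<Prod>q | prime q \<and> q \<le> z. real (card (fundamental_residues q)) / real (local_modulus q)) \<longlonglongrightarrow> c"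
proof -
  let ?f = "\<lambda>q. real (card (fundamental_residues q)) / real (local_modulus q)"
  let ?a = "\<lambda>z. \<Prod>q | prime q \<and> q \<le> z. ?f q"
  have Suc_eq: "?a (Suc z) = (if prime (Suc z) then ?f (Suc z) else 1) * ?a z" for z
  proof (cases "prime (Suc z)")
    case True
    then have "{q. prime q \<and> q \<le> Suc z} = insert (Suc z) {q. prime q \<and> q \<le> z}"
      by (auto simp: le_Suc_eq)
    with True finite_primes_le[of z] show ?thesis by simp
  next
    case False
    then have "{q. prime q \<and> q \<le> Suc z} = {q. prime q \<and> q \<le> z}"
      by (auto simp: le_Suc_eq)
    with False show ?thesis by simp
  qed
  have nonneg: "?a z \<ge> 0" for z by (intro prod_nonneg) simp
  have f_le: "?f q \<le> 1" for q
  proof -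
    have "card (fundamental_residues q) \<le> local_modulus q"
      using card_mono[OF _ fundamental_residues_subset[of q]] by simp
    then show ?thesis by (cases "local_modulus q = 0") (auto simp: divide_le_eq_1)
  qed
  have dec: "decseq ?a"
  proof (rule decseq_SucI)
    fix z
    have "(if prime (Suc z) then ?f (Suc z) else 1) * ?a z \<le> 1 * ?a z"
      using f_le nonneg by (intro mult_right_mono) auto
    then show "?a (Suc z) \<le> ?a z" by (simp add: Suc_eq)
  qed
  \<comment> \<open>The bound is exact at \<open>z = 2\<close>, where both sides are 3/8. It
    survives a prime \<open>z + 1\<close> because
    \<open>(1 - 1 / (z + 1)\<^sup>2) * (1 + 1 / z) = 1 + 1 / (z + 1)\<close>.\<close>
  have lower: "(1 + 1 / real z) / 4 \<le> ?a z" if "z \<ge> 2" for z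
    using that
  proof (induction z rule: dec_induct)
    case base
    have "{q::nat. prime q \<and> q \<le> 2} = {2}" by (auto dest: prime_ge_2_nat)
    then show ?case by (simp add: card_fundamental_residues local_modulus_def)
  next
    case (step z)
    show ?case
    proof (cases "prime (Suc z)")
      case True
      have eq: "?f (Suc z) = 1 - 1 / (real (Suc z))\<^sup>2"
        using step(1) by (simp add: card_fundamental_residues local_modulus_def of_nat_diff diff_divide_distrib)
      have "(1 + 1 / real (Suc z)) / 4 = ?f (Suc z) * ((1 + 1 / real z) / 4)"
        unfolding eq using step(1) by (simp add: divide_simps power2_eq_square) (simp add: algebra_simps)
      also have "\<dots> \<le> ?f (Suc z) * ?a z"
        by (rule mult_left_mono[OF step.IH]) simp
      finally show ?thesis using True by (simp only: Suc_eq if_True)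
    next
      case False
      have "(1 + 1 / real (Suc z)) / 4 \<le> (1 + 1 / real z) / 4"
        using step(1) by (simp add: field_simps)
      with step.IH False show ?thesis by (simp add: Suc_eq)
    qed
  qed
  obtain c where c: "?a \<longlonglongrightarrow> c"
    using decseq_convergent[OF dec, of 0] nonneg by blast
  have "1 / 4 \<le> c"
  proof (rule LIMSEQ_le_const[OF c], intro exI allI impI)
    fix z :: nat assume "2 \<le> z"
    moreover have "1 / 4 \<le> (1 + 1 / real z) / 4" by simp
    ultimately show "1 / 4 \<le> ?a z" using lower[of z] by linarith
  qed
  with c show ?thesis by (intro that[of c]) auto
qed

text \<open>Tightening the conditions at finitely many primes changes finitely many factors of the
  convergent product. The constant \<open>c\<close> is fixed before \<open>S\<close> and
  \<open>C\<close>, so it is common to all sign patterns and can cancel.\<close>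

lemma density_local_conditions:
  obtains c where "c > 0"
    "\<And>S C. finite S \<Longrightarrow> (\<And>q. q \<in> S \<Longrightarrow> prime q) \<Longrightarrow> (\<And>q. q \<in> S \<Longrightarrow> C q \<subseteq> fundamental_residues q) \<Longrightarrow>
      has_density {n. (\<forall>q. prime q \<longrightarrow> n mod local_modulus q \<in> fundamental_residues q) \<and>
                      (\<forall>q\<in>S. n mod local_modulus q \<in> C q)}
        (c * (\<Prod>q\<in>S. real (card (C q)) / real (card (fundamental_residues q))))"
proof -
  let ?f = "\<lambda>q. real (card (fundamental_residues q)) / real (local_modulus q)"
  obtain c where c: "c > 0" "(\<lambda>z. \<Prod>q | prime q \<and> q \<le> z. ?f q) \<longlonglongrightarrow> c"
    using fundamental_euler_product by blast
  have "has_density {n. (\<forall>q. prime q \<longrightarrow> n mod local_modulus q \<in> fundamental_residues q) \<and>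
                      (\<forall>q\<in>S. n mod local_modulus q \<in> C q)}
        (c * (\<Prod>q\<in>S. real (card (C q)) / real (card (fundamental_residues q))))"
    if S: "finite S" "\<And>q. q \<in> S \<Longrightarrow> prime q" and C: "\<And>q. q \<in> S \<Longrightarrow> C q \<subseteq> fundamental_residues q" for S C
  proof -
    define C' where "C' q = (if q \<in> S then C q else fundamental_residues q)" for q
    define z0 where "z0 = Max (insert 0 S)"
    have z0: "q \<le> z0" if "q \<in> S" for q using S(1) that by (simp add: z0_def)
    let ?w = "\<Prod>q\<in>S. real (card (C q)) / real (card (fundamental_residues q))"
    have prod_eq: "(\<Prod>q | prime q \<and> q \<le> z. ?f q) * ?w =
        (\<Prod>q | prime q \<and> q \<le> z. real (card (C' q)) / real (local_modulus q))" if "z \<ge> z0" for z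
    proof -
      let ?T = "{q. prime q \<and> q \<le> z}"
      have sub: "S \<subseteq> ?T" using S(2) z0 that by (auto intro: order_trans)
      have nonempty: "fundamental_residues q \<noteq> {}" if "prime q" for q
        using prime_gt_1_nat[OF that] less_1_mult[of q q]
        by (auto simp: fundamental_residues_def power2_eq_square)
      \<comment> \<open>At primes outside \<open>S\<close> the added factors are quotients of equal
        non-zero cardinalities, hence 1.\<close>
      have w: "?w = (\<Prod>q\<in>?T. real (card (C' q)) / real (card (fundamental_residues q)))"
        using sub finite_primes_le[of z] nonempty
        by (intro prod.mono_neutral_cong_left) (auto simp: C'_def)
      have "?f q * (real (card (C' q)) / real (card (fundamental_residues q))) =
          real (card (C' q)) / real (local_modulus q)" if "prime q" for q
        using nonempty[OF that] by simp
      then show ?thesis unfolding w prod.distrib[symmetric] by (intro prod.cong) auto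
    qed
    have "(\<lambda>z. (\<Prod>q | prime q \<and> q \<le> z. ?f q) * ?w) \<longlonglongrightarrow> c * ?w"
      by (intro tendsto_mult c tendsto_const)
    then have "(\<lambda>z. \<Prod>q | prime q \<and> q \<le> z. real (card (C' q)) / real (local_modulus q)) \<longlonglongrightarrow> c * ?w"
      by (rule Lim_transform_eventually)
         (use prod_eq in \<open>auto simp: eventually_sequentially intro!: exI[of _ z0]\<close>)
    moreover have "C' q \<subseteq> {..<local_modulus q}" for q
      using subset_trans[OF C fundamental_residues_subset] fundamental_residues_subset
      by (simp add: C'_def)
    moreover have "C' q = fundamental_residues q" if "q > z0" for q
      using z0[of q] that by (auto simp: C'_def)
    ultimately have "has_density {n. \<forall>q. prime q \<longrightarrow> n mod local_modulus q \<in> C' q} (c * ?w)"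
      by (intro has_density_local_conditions[where ?z0.0=z0])
    moreover have "n mod local_modulus q \<in> C' q \<longleftrightarrow>
        n mod local_modulus q \<in> fundamental_residues q \<and> (q \<in> S \<longrightarrow> n mod local_modulus q \<in> C q)" for n q
      using C[of q] by (auto simp: C'_def)
    then have "{n. \<forall>q. prime q \<longrightarrow> n mod local_modulus q \<in> C' q} =
      {n. (\<forall>q. prime q \<longrightarrow> n mod local_modulus q \<in> fundamental_residues q) \<and>
          (\<forall>q\<in>S. n mod local_modulus q \<in> C q)}"
      using S(2) by blast
    ultimately show ?thesis by simp
  qed
  with c(1) show ?thesis by (rule that)
qed

section \<open>Fundamental discriminants and their local weights\<close>

lemma squarefree_int_iff:
  assumes "n > 0"
  shows "squarefree (int n) \<longleftrightarrow> (\<forall>q. prime q \<longrightarrow> \<not> q\<^sup>2 dvd n)"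
proof -
  have "squarefree (int n) \<longleftrightarrow> (\<forall>p::int. prime p \<longrightarrow> \<not> p\<^sup>2 dvd int n)"
    using assms by (intro squarefree_factorial_semiring) simp
  also have "\<dots> \<longleftrightarrow> (\<forall>q::nat. prime q \<longrightarrow> \<not> (int q)\<^sup>2 dvd int n)"
    by (metis prime_ge_0_int prime_nat_int_transfer zero_le_imp_eq_int)
  also have "\<dots> \<longleftrightarrow> (\<forall>q. prime q \<longrightarrow> \<not> q\<^sup>2 dvd n)"
    by (simp flip: of_nat_power)
  finally show ?thesis .
qed

lemma fundamental_discriminant_int_iff:
  "fundamental_discriminant (int n) \<longleftrightarrow>
     n mod 4 = 1 \<and> squarefree (int n) \<or>
     (\<exists>m. n = 4 * m \<and> m mod 4 \<in> {2, 3} \<and> squarefree (int m))"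
proof -
  have mod_4: "int k mod 4 = int (k mod 4)" for k by (simp add: zmod_int)
  have "(\<exists>m. int n = 4 * m \<and> m mod 4 \<in> {2, 3} \<and> squarefree m) \<longleftrightarrow>
        (\<exists>m. n = 4 * m \<and> m mod 4 \<in> {2, 3} \<and> squarefree (int m))"
  proof (intro iffI; elim exE conjE)
    fix m :: int assume m: "int n = 4 * m" "squarefree m" and mod: "m mod 4 \<in> {2, 3}"
    then obtain k where k: "m = int k" by (metis nonneg_int_cases of_nat_0_le_iff zero_le_mult_iff zero_less_numeral not_le)
    have "n = 4 * k" using m k by linarith
    moreover have "k mod 4 \<in> {2, 3}" using mod mod_4[of k] unfolding k by auto
    ultimately show "\<exists>m. n = 4 * m \<and> m mod 4 \<in> {2, 3} \<and> squarefree (int m)"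
      using m(2) k by blast
  next
    fix m :: nat assume m: "n = 4 * m" "squarefree (int m)" and mod: "m mod 4 \<in> {2, 3}"
    have "int m mod 4 \<in> {2, 3}" using mod mod_4[of m] by auto
    with m show "\<exists>m'. int n = 4 * m' \<and> m' mod 4 \<in> {2, 3} \<and> squarefree m'"
      by (intro exI[of _ "int m"]) auto
  qed
  moreover have "int n mod 4 = 1 \<longleftrightarrow> n mod 4 = 1" using mod_4[of n] by auto
  ultimately show ?thesis by (simp add: fundamental_discriminant_def)
qed

lemma odd_prime_square_dvd_4_mult:
  assumes "prime (q::nat)" "q \<noteq> 2"
  shows "q\<^sup>2 dvd 4 * m \<longleftrightarrow> q\<^sup>2 dvd m"
proof -
  have "coprime (q\<^sup>2) (2\<^sup>2)"
    using assms primes_coprime[of q 2] by (intro coprime_power_left_iff[THEN iffD2] coprime_power_right_iff[THEN iffD2]) auto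
  then show ?thesis by (simp add: coprime_dvd_mult_right_iff)
qed

text \<open>The condition modulo 16 fixes the shape of \<open>n\<close> and already excludes the
  square factor 4 of \<open>n\<close>, respectively of \<open>m\<close> when
  \<open>n = 4 * m\<close>. For odd primes \<open>q\<close>, \<open>q\<^sup>2\<close> divides
  \<open>4 * m\<close> exactly if it divides \<open>m\<close>, so squarefreeness can be tested on
  \<open>n\<close> in both cases.\<close>

lemma fundamental_discriminant_iff_local:
  "fundamental_discriminant (int n) \<longleftrightarrow>
     (\<forall>q. prime q \<longrightarrow> n mod local_modulus q \<in> fundamental_residues q)"
proof -
  have odd_iff: "n mod local_modulus q \<in> fundamental_residues q \<longleftrightarrow> \<not> q\<^sup>2 dvd n"
    if "prime q" "q \<noteq> 2" for q
    using that by (auto simp: local_modulus_def fundamental_residues_def dvd_eq_mod_eq_0 prime_gt_0_nat)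
  have mod_16: "n mod 16 mod 4 = n mod 4" by (simp add: mod_mod_cancel)
  have "(\<forall>q. prime q \<longrightarrow> n mod local_modulus q \<in> fundamental_residues q) \<longleftrightarrow>
      n mod 16 \<in> {1, 5, 8, 9, 12, 13} \<and> (\<forall>q. prime q \<and> q \<noteq> 2 \<longrightarrow> \<not> q\<^sup>2 dvd n)"
  proof (intro iffI conjI allI impI)
    assume *: "\<forall>q. prime q \<longrightarrow> n mod local_modulus q \<in> fundamental_residues q"
    show "n mod 16 \<in> {1, 5, 8, 9, 12, 13}"
      using *[rule_format, of 2] by (simp add: local_modulus_def fundamental_residues_def)
    show "\<not> q\<^sup>2 dvd n" if "prime q \<and> q \<noteq> 2" for q
      using * that odd_iff by blast
  next
    fix q :: nat
    assume *: "n mod 16 \<in> {1, 5, 8, 9, 12, 13} \<and> (\<forall>q. prime q \<and> q \<noteq> 2 \<longrightarrow> \<not> q\<^sup>2 dvd n)" "prime q"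
    show "n mod local_modulus q \<in> fundamental_residues q"
    proof (cases "q = 2")
      case True
      with * show ?thesis by (simp add: local_modulus_def fundamental_residues_def)
    next
      case False
      with * show ?thesis by (simp add: odd_iff)
    qed
  qed
  also have "\<dots> \<longleftrightarrow> fundamental_discriminant (int n)"
  proof
    assume *: "n mod 16 \<in> {1, 5, 8, 9, 12, 13} \<and> (\<forall>q. prime q \<and> q \<noteq> 2 \<longrightarrow> \<not> q\<^sup>2 dvd n)"
    then have odd: "\<And>q. prime q \<Longrightarrow> q \<noteq> 2 \<Longrightarrow> \<not> q\<^sup>2 dvd n" by blast
    have "n mod 4 = 1 \<or> n mod 16 = 4 * 2 \<or> n mod 16 = 4 * 3" using * mod_16 by auto
    then consider "n mod 4 = 1" | r where "r \<in> {2, 3}" "n mod 16 = 4 * r" by blast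
    then show "fundamental_discriminant (int n)"
    proof cases
      case 1
      have "\<not> 2\<^sup>2 dvd n" using 1 by (simp add: dvd_eq_mod_eq_0)
      then have "\<not> q\<^sup>2 dvd n" if "prime q" for q using odd[OF that] by (cases "q = 2") auto
      moreover have "n > 0" using 1 by (auto intro!: gr0I)
      ultimately have "squarefree (int n)" by (simp add: squarefree_int_iff)
      with 1 show ?thesis by (simp add: fundamental_discriminant_int_iff)
    next
      case 2
      \<comment> \<open>This is \<open>n div 4\<close>, written so that \<open>m mod 4 = r\<close>
        is apparent from \<open>n = 16 * (n div 16) + 4 * r\<close>.\<close>
      define m where "m = 4 * (n div 16) + r"
      have r: "r < 4" "r \<noteq> 0" using 2(1) by auto
      have m: "n = 4 * m" "m mod 4 = r"
        using 2(2) div_mult_mod_eq[of n 16] r by (simp_all add: m_def)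
      have "\<not> 2\<^sup>2 dvd m" using m r by (simp add: dvd_eq_mod_eq_0)
      then have "\<not> q\<^sup>2 dvd m" if "prime q" for q
        using odd[OF that] odd_prime_square_dvd_4_mult[OF that, of m] m(1) by (cases "q = 2") auto
      moreover have "m > 0" using m r by (auto intro!: gr0I)
      ultimately have "squarefree (int m)" by (simp add: squarefree_int_iff)
      with m 2(1) show ?thesis unfolding fundamental_discriminant_int_iff by blast
    qed
  next
    assume "fundamental_discriminant (int n)"
    then consider "n mod 4 = 1" "squarefree (int n)"
      | m where "n = 4 * m" "m mod 4 \<in> {2, 3}" "squarefree (int m)"
      by (auto simp only: fundamental_discriminant_int_iff)
    then show "n mod 16 \<in> {1, 5, 8, 9, 12, 13} \<and> (\<forall>q. prime q \<and> q \<noteq> 2 \<longrightarrow> \<not> q\<^sup>2 dvd n)"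
    proof cases
      case 1
      have "n > 0" using 1 by (auto intro: gr0I)
      with 1 have "\<not> q\<^sup>2 dvd n" if "prime q" for q using that by (simp add: squarefree_int_iff)
      moreover have "n mod 16 \<in> {1, 5, 9, 13}"
      proof -
        have "n mod 16 = 4 * (n mod 16 div 4) + 1"
          using mult_div_mod_eq[of 4 "n mod 16"] 1(1) mod_16 by simp
        moreover have "n mod 16 div 4 \<in> {0, 1, 2, 3}" by auto
        ultimately show ?thesis by auto
      qed
      ultimately show ?thesis by auto
    next
      case 2
      have "m > 0" using 2 by (auto intro: gr0I)
      with 2 have "\<not> q\<^sup>2 dvd m" if "prime q" for q using that by (simp add: squarefree_int_iff)
      moreover have "n mod 16 \<in> {8, 12}"
      proof -
        have "m = 4 * (m div 4) + m mod 4" by simp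
        then have "n = 16 * (m div 4) + 4 * (m mod 4)" using 2(1) by linarith
        then show ?thesis using 2(2) by auto
      qed
      ultimately show ?thesis using 2(1) by (auto simp: odd_prime_square_dvd_4_mult)
    qed
  qed
  finally show ?thesis by simp
qed

section \<open>The Kronecker symbol at a prime\<close>

lemma kronecker_prime_arg:
  assumes "prime q"
  shows "kronecker a (int q) = kronecker_prime a (int q)"
proof -
  have q: "prime (int q)" "q > 0" using assms by (simp_all add: prime_gt_0_nat)
  then show ?thesis by (simp add: kronecker_def prime_prime_factors)
qed

lemma kronecker_1_right [simp]: "kronecker a 1 = 1"
  by (simp add: kronecker_def)

lemma Legendre_cong:
  assumes "[a = b] (mod p)"
  shows "Legendre a p = Legendre b p"
proof -
  have "[a = 0] (mod p) \<longleftrightarrow> [b = 0] (mod p)" using assms by (simp add: cong_def)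
  moreover have "QuadRes p a \<longleftrightarrow> QuadRes p b" using assms by (simp add: QuadRes_def cong_def)
  ultimately show ?thesis by (simp add: Legendre_def)
qed

text \<open>The symbol at 2 depends on the residue modulo 8, and the one at odd \<open>q\<close> on
  the residue modulo \<open>q\<close>. Both moduli divide \<open>local_modulus q\<close>.\<close>

lemma kronecker_prime_mod:
  "kronecker_prime (int (n mod local_modulus q)) (int q) = kronecker_prime (int n) (int q)"
proof (cases "q = 2")
  case True
  have "int (n mod 16) mod 8 = int n mod 8" by (simp add: zmod_int mod_mod_cancel)
  moreover have "even (n mod 16) \<longleftrightarrow> even n" by (rule dvd_mod_iff) simp
  ultimately show ?thesis using True unfolding kronecker_prime_def local_modulus_def by simp
next
  case False
  have "int (n mod q\<^sup>2) mod int q = int n mod int q"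
    by (simp add: mod_mod_cancel flip: of_nat_mod)
  then have "[int (n mod q\<^sup>2) = int n] (mod int q)" by (simp add: cong_def)
  then show ?thesis using False by (simp add: kronecker_prime_def local_modulus_def Legendre_cong)
qed

lemma kronecker_prime_values: "kronecker_prime a p \<in> {-1, 0, 1}"
  by (simp add: kronecker_prime_def Legendre_def)

section \<open>Counting residues with a prescribed symbol\<close>

lemma card_residues_square_modulus:
  fixes q :: nat
  assumes "R \<subseteq> {..<q}"
  shows "card {r. r < q\<^sup>2 \<and> r mod q \<in> R} = q * card R"
proof -
  have "bij_betw (\<lambda>(t, s). q * t + s) ({..<q} \<times> R) {r. r < q\<^sup>2 \<and> r mod q \<in> R}"
  proof (rule bij_betwI[where g="\<lambda>r. (r div q, r mod q)"])
    show "(\<lambda>(t, s). q * t + s) \<in> {..<q} \<times> R \<rightarrow> {r. r < q\<^sup>2 \<and> r mod q \<in> R}"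
    proof (rule Pi_I)
      fix x assume "x \<in> {..<q} \<times> R"
      then obtain t s where x: "x = (t, s)" "t < q" "s \<in> R" by auto
      then have s: "s < q" using assms by auto
      have "q * t + s < q * Suc t" using s by simp
      also have "\<dots> \<le> q * q" using x by (intro mult_left_mono) auto
      finally show "(case x of (t, s) \<Rightarrow> q * t + s) \<in> {r. r < q\<^sup>2 \<and> r mod q \<in> R}"
        using x s by (simp add: power2_eq_square)
    qed
    show "(\<lambda>r. (r div q, r mod q)) \<in> {r. r < q\<^sup>2 \<and> r mod q \<in> R} \<rightarrow> {..<q} \<times> R"
      by (auto simp: power2_eq_square less_mult_imp_div_less)
  qed (use assms in auto)
  then have "card ({..<q} \<times> R) = card {r. r < q\<^sup>2 \<and> r mod q \<in> R}" by (rule bij_betw_same_card)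
  then show ?thesis by (simp add: card_cartesian_product)
qed

text \<open>The squares of \<open>1, ..., (q - 1) div 2\<close> are distinct modulo
  \<open>q\<close>: for \<open>x < y\<close> in this range, \<open>q\<close> divides neither
  \<open>y + x\<close> nor \<open>y - x\<close>, as both lie strictly between 0 and
  \<open>q\<close>. They exhaust the non-zero squares because \<open>x\<close> and
  \<open>q - x\<close> have the same square.\<close>

lemma card_quadratic_residues:
  assumes q: "prime q" "odd (q::nat)"
  shows "card {s \<in> {1..<q}. QuadRes (int q) (int s)} = (q - 1) div 2"
proof -
  let ?f = "\<lambda>x. x\<^sup>2 mod q"
  have q0: "q > 0" using q prime_gt_0_nat by blast
  have ndvd: "\<not> q dvd x" if "0 < x" "x < q" for x using that by (auto dest: dvd_imp_le)
  have "inj_on ?f {1..(q - 1) div 2}"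
  proof (rule linorder_inj_onI')
    fix x y assume *: "x \<in> {1..(q - 1) div 2}" "y \<in> {1..(q - 1) div 2}" "x < y"
    show "?f x \<noteq> ?f y"
    proof
      assume "?f x = ?f y"
      then have "q dvd y\<^sup>2 - x\<^sup>2" 
        using mod_eq_dvd_iff_nat[of "x\<^sup>2" "y\<^sup>2" q] *(3) by (simp add: power_mono)
      also have "y\<^sup>2 - x\<^sup>2 = (y + x) * (y - x)"
        using *(3) by (auto simp: power2_eq_square algebra_simps less_iff_Suc_add)
      finally have "q dvd y + x \<or> q dvd y - x" using q(1) by (simp add: prime_dvd_mult_iff)
      moreover have "x + y < q" using * q0 by auto
      ultimately show False using ndvd[of "y + x"] ndvd[of "y - x"] * by auto
    qed
  qed
  then have "card (?f ` {1..(q - 1) div 2}) = (q - 1) div 2" by (simp add: card_image)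
  also have "?f ` {1..(q - 1) div 2} = {s \<in> {1..<q}. QuadRes (int q) (int s)}"
  proof (intro equalityI subsetI)
    fix s assume "s \<in> ?f ` {1..(q - 1) div 2}"
    then obtain x where x: "x \<in> {1..(q - 1) div 2}" "s = x\<^sup>2 mod q" by blast
    have "0 < x" "x < q" using x(1) q0 by auto
    then have "\<not> q dvd x\<^sup>2" using ndvd[of x] q(1) by (simp add: prime_dvd_power_iff)
    then have "s \<in> {1..<q}" using x(2) q0 by (auto simp: dvd_eq_mod_eq_0 Suc_le_eq)
    moreover have "[(int x)\<^sup>2 = int s] (mod int q)" by (simp add: x(2) cong_def zmod_int)
    ultimately show "s \<in> {s \<in> {1..<q}. QuadRes (int q) (int s)}" by (auto simp: QuadRes_def)
  next
    fix s assume s: "s \<in> {s \<in> {1..<q}. QuadRes (int q) (int s)}"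
    then obtain y where y: "[y\<^sup>2 = int s] (mod int q)" by (auto simp: QuadRes_def)
    define x where "x = nat (y mod int q)"
    have x: "int x = y mod int q" "x < q" using q0 by (simp_all add: x_def nat_less_iff)
    have "int (x\<^sup>2 mod q) = int s mod int q"
      using y by (simp add: zmod_int x(1) cong_def power_mod)
    also have "\<dots> = int s" using s by simp
    finally have xs: "x\<^sup>2 mod q = s" by linarith
    then have "x > 0" using s by (auto intro: gr0I)
    show "s \<in> ?f ` {1..(q - 1) div 2}"
    proof (cases "x \<le> (q - 1) div 2")
      case True
      with \<open>x > 0\<close> xs show ?thesis by (auto intro!: image_eqI[of _ _ x])
    next
      case False
      have "int ((q - x)\<^sup>2 mod q) = int (x\<^sup>2 mod q)"
      proof -
        have "[(int q - int x)\<^sup>2 = (int x)\<^sup>2] (mod int q)"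
          unfolding cong_iff_dvd_diff by (auto simp: power2_eq_square algebra_simps)
        then show ?thesis using x(2) by (simp add: zmod_int of_nat_diff cong_def)
      qed
      then have "?f (q - x) = s" using xs by simp
      moreover have "q - x \<in> {1..(q - 1) div 2}" using False x(2) q(2) by (auto elim: oddE)
      ultimately show ?thesis by blast
    qed
  qed
  finally show ?thesis .
qed

text \<open>This is the proportion of \<open>fundamental_residues q\<close> on which the symbol at a
  prime \<open>q\<close> equals \<open>s\<close>. The three weights for \<open>s = 0, 1, -1\<close>
  add up to 1.\<close>

definition local_weight :: "nat \<Rightarrow> int \<Rightarrow> real" where
  "local_weight q s = (if s = 0 then 1 / (real q + 1) else real q / (2 * (real q + 1)))"

text \<open>Among the \<open>(q - 1) * (q + 1)\<close> admissible residues, \<open>q - 1\<close> are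
  multiples of \<open>q\<close>. The quadratic residues and the non-residues modulo \<open>q\<close>
  each have \<open>q * (q - 1) / 2\<close> lifts. The factor \<open>q - 1\<close> cancels.\<close>

lemma local_density_odd:
  assumes q: "prime q" "q \<noteq> 2" and s: "s \<in> {-1, 0, 1}"
  shows "real (card {r \<in> fundamental_residues q. kronecker_prime (int r) (int q) = s}) /
         real (card (fundamental_residues q)) = local_weight q s"
proof -
  have q2: "q > 2" "odd q" using q prime_ge_2_nat[of q] prime_odd_nat[of q] by auto
  let ?X = "\<lambda>s. {r \<in> fundamental_residues q. kronecker_prime (int r) (int q) = s}"
  let ?Q = "{s \<in> {1..<q}. QuadRes (int q) (int s)}"
  have kp: "kronecker_prime (int r) (int q) =
      (if r mod q = 0 then 0 else if QuadRes (int q) (int (r mod q)) then 1 else -1)" for r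
  proof -
    have "Legendre (int r) (int q) = Legendre (int (r mod q)) (int q)"
      by (rule Legendre_cong) (simp add: cong_def zmod_int)
    moreover have "[int (r mod q) = 0] (mod int q) \<longleftrightarrow> r mod q = 0"
      by (simp add: cong_def flip: zmod_int)
    ultimately show ?thesis using q2 by (simp add: kronecker_prime_def Legendre_def)
  qed
  have res: "fundamental_residues q = {r. r < q\<^sup>2 \<and> r \<noteq> 0}"
    using q by (auto simp: fundamental_residues_def)
  have total: "real (card (fundamental_residues q)) = (real q - 1) * (real q + 1)"
    using q2 by (simp add: card_fundamental_residues of_nat_diff power2_eq_square algebra_simps)
  have "card (?X 0) = q - 1"
  proof -
    \<comment> \<open>Of the \<open>q\<close> multiples of \<open>q\<close> below
      \<open>q\<^sup>2\<close>, only 0 is not admissible.\<close>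
    have "?X 0 = {r. r < q\<^sup>2 \<and> r mod q \<in> {0}} - {0}" by (auto simp: res kp split: if_splits)
    then show ?thesis using q2 card_residues_square_modulus[of "{0}" q] by simp
  qed
  moreover have "card (?X 1) = q * ((q - 1) div 2)"
  proof -
    have "?X 1 = {r. r < q\<^sup>2 \<and> r mod q \<in> ?Q}" using q2 by (auto simp: res kp Suc_le_eq intro!: gr0I split: if_splits)
    also have "card \<dots> = q * card ?Q" by (rule card_residues_square_modulus) auto
    finally show ?thesis using card_quadratic_residues[of q] q(1) q2 by simp
  qed
  moreover have "card (?X (-1)) = q * ((q - 1) div 2)"
  proof -
    have "?X (-1) = {r. r < q\<^sup>2 \<and> r mod q \<in> {1..<q} - ?Q}"
      using q2 by (auto simp: res kp Suc_le_eq intro!: gr0I split: if_splits)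
    also have "card \<dots> = q * card ({1..<q} - ?Q)" by (rule card_residues_square_modulus) auto
    also have "card ({1..<q} - ?Q) = (q - 1) - (q - 1) div 2"
      using card_quadratic_residues[of q] q(1) q2 by (subst card_Diff_subset) auto
    also have "\<dots> = (q - 1) div 2" using q2 by (auto elim!: oddE)
    finally show ?thesis .
  qed
  moreover have "real ((q - 1) div 2) = (real q - 1) / 2" using q2 by (auto elim!: oddE)
  moreover have "real (q - 1) = real q - 1" using q2 by simp
  ultimately have "real (card (?X 0)) = real q - 1" "real (card (?X 1)) = real q * ((real q - 1) / 2)"
    "real (card (?X (-1))) = real q * ((real q - 1) / 2)"
    by (simp_all only: of_nat_mult)
  then have "real (card (?X s)) = (real q - 1) * (if s = 0 then 1 else real q / 2)"
    using s by auto
  moreover have "real q - 1 \<noteq> 0" using q2 by simp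
  ultimately show ?thesis unfolding total by (simp add: local_weight_def)
qed

text \<open>Each symbol value is taken by two of the six residues. The resulting 1/3 agrees with
  both branches of the general weight at \<open>q = 2\<close>.\<close>

lemma local_density_2:
  assumes s: "s \<in> {-1, 0, 1}"
  shows "real (card {r \<in> fundamental_residues 2. kronecker_prime (int r) 2 = s}) /
         real (card (fundamental_residues 2)) = local_weight 2 s"
proof -
  have "{r \<in> fundamental_residues 2. kronecker_prime (int r) 2 = s} =
    (if s = 0 then {8, 12} else if s = 1 then {1, 9} else {5, 13})"
    using s by (auto simp: fundamental_residues_def kronecker_prime_def)
  then show ?thesis using s by (auto simp: card_fundamental_residues local_weight_def)
qed

lemma local_density:
  assumes "prime q" "s \<in> {-1, 0, 1}"
  shows "real (card {r \<in> fundamental_residues q. kronecker_prime (int r) (int q) = s}) /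
         real (card (fundamental_residues q)) = local_weight q s"
  using local_density_odd[OF assms(1) _ assms(2)] local_density_2[OF assms(2)]
  by (cases "q = 2") auto

section \<open>Signs of the twisted divisor sum\<close>

definition signed_discriminants :: "'a set \<Rightarrow> ('a \<Rightarrow> nat) \<Rightarrow> ('a \<Rightarrow> int) \<Rightarrow> nat set" where
  "signed_discriminants I p s =
     {n. int n \<in> real_quadratic_discriminants \<and> (\<forall>i\<in>I. kronecker (int n) (int (p i)) = s i)}"

lemma density_signed_discriminants:
  obtains c where "c > 0"
    "\<And>(I :: 'a set) p s. finite I \<Longrightarrow> inj_on p I \<Longrightarrow> (\<And>i. i \<in> I \<Longrightarrow> prime (p i)) \<Longrightarrow>
       (\<And>i. i \<in> I \<Longrightarrow> s i \<in> {-1, 0, 1}) \<Longrightarrow>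
       has_density (signed_discriminants I p s) (c * (\<Prod>i\<in>I. local_weight (p i) (s i)))"
proof -
  obtain c where c: "c > 0"
    "\<And>S C. finite S \<Longrightarrow> (\<And>q. q \<in> S \<Longrightarrow> prime q) \<Longrightarrow> (\<And>q. q \<in> S \<Longrightarrow> C q \<subseteq> fundamental_residues q) \<Longrightarrow>
      has_density {n. (\<forall>q. prime q \<longrightarrow> n mod local_modulus q \<in> fundamental_residues q) \<and>
                      (\<forall>q\<in>S. n mod local_modulus q \<in> C q)}
        (c * (\<Prod>q\<in>S. real (card (C q)) / real (card (fundamental_residues q))))"
    using density_local_conditions by blast
  have "has_density (signed_discriminants I p s) (c * (\<Prod>i\<in>I. local_weight (p i) (s i)))"
    if I: "finite I" "inj_on p I" "\<And>i. i \<in> I \<Longrightarrow> prime (p i)" "\<And>i. i \<in> I \<Longrightarrow> s i \<in> {-1, 0, 1}"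
    for I :: "'a set" and p s
  proof -
    \<comment> \<open>The sign is attached to an index, the residue condition to a prime.
      Injectivity of \<open>p\<close> makes the translation well defined.\<close>
    define C where "C q = {r \<in> fundamental_residues q.
      kronecker_prime (int r) (int q) = s (the_inv_into I p q)}" for q
    have inv: "the_inv_into I p (p i) = i" if "i \<in> I" for i
      using that I(2) by (rule the_inv_into_f_f[rotated])
    let ?V = "{n. (\<forall>q. prime q \<longrightarrow> n mod local_modulus q \<in> fundamental_residues q) \<and>
                  (\<forall>q\<in>p ` I. n mod local_modulus q \<in> C q)}"
    have "has_density ?V (c * (\<Prod>q\<in>p ` I. real (card (C q)) / real (card (fundamental_residues q))))"
      using I by (intro c(2)) (auto simp: C_def)
    also have "(\<Prod>q\<in>p ` I. real (card (C q)) / real (card (fundamental_residues q))) =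
        (\<Prod>i\<in>I. local_weight (p i) (s i))"
      unfolding prod.reindex[OF I(2)] o_def
      using I(3,4) by (intro prod.cong) (simp_all add: C_def inv local_density)
    finally have "has_density (?V - {1}) (c * (\<Prod>i\<in>I. local_weight (p i) (s i)))"
      by (rule has_density_Diff_finite) simp
    also have "?V - {1} = signed_discriminants I p s"
    proof (intro Set.set_eqI)
      fix n
      have "n \<in> ?V \<longleftrightarrow> fundamental_discriminant (int n) \<and> (\<forall>i\<in>I. n mod local_modulus (p i) \<in> C (p i))"
        by (simp add: fundamental_discriminant_iff_local)
      also have "\<dots> \<longleftrightarrow> fundamental_discriminant (int n) \<and> (\<forall>i\<in>I. kronecker (int n) (int (p i)) = s i)"
        using I(3) by (auto simp: fundamental_discriminant_iff_local C_def inv kronecker_prime_mod kronecker_prime_arg)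
      finally have V: "n \<in> ?V \<longleftrightarrow>
        fundamental_discriminant (int n) \<and> (\<forall>i\<in>I. kronecker (int n) (int (p i)) = s i)" .
      have "\<not> fundamental_discriminant (int 0)"
        by (auto simp: fundamental_discriminant_def)
      then have "fundamental_discriminant (int n) \<Longrightarrow> n \<noteq> 1 \<Longrightarrow> n > 1"
        by (cases "n = 0") auto
      then show "n \<in> ?V - {1} \<longleftrightarrow> n \<in> signed_discriminants I p s"
        unfolding Diff_iff V signed_discriminants_def real_quadratic_discriminants_def by auto
    qed
    finally show ?thesis .
  qed
  with c(1) show ?thesis by (rule that)
qed

text \<open>Positive integers are identified with naturals, and the real bound may be rounded down
  because the products are integers. The general predicate \<open>P\<close> covers both the set of
  all pairs and the pairs with one prescribed pattern of symbol values.\<close>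

lemma card_int_pairs_eq_hyperbola_count:
  assumes "x \<ge> 0"
    and sub: "\<And>D1 D2. P D1 D2 \<Longrightarrow> D1 > 0 \<and> D2 > 0"
    and P: "\<And>m n. P (int m) (int n) \<longleftrightarrow> m \<in> A \<and> n \<in> B"
  shows "card {(D1, D2). P D1 D2 \<and> \<bar>real_of_int (D1 * D2)\<bar> \<le> x} = hyperbola_count A B (nat \<lfloor>x\<rfloor>)"
proof -
  have le: "\<bar>real_of_int (int m * int n)\<bar> \<le> x \<longleftrightarrow> m * n \<le> nat \<lfloor>x\<rfloor>" for m n
  proof -
    have "\<bar>real_of_int (int m * int n)\<bar> = real (m * n)" by simp
    then show ?thesis using assms(1) by (simp add: le_nat_iff le_floor_iff del: of_nat_mult)
  qed
  have "bij_betw (map_prod int int) {(a, b). a \<in> A \<and> b \<in> B \<and> 0 < a \<and> 0 < b \<and> a * b \<le> nat \<lfloor>x\<rfloor>}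
          {(D1, D2). P D1 D2 \<and> \<bar>real_of_int (D1 * D2)\<bar> \<le> x}"
  proof (rule bij_betwI[where g="map_prod nat nat"])
    show "map_prod int int \<in> {(a, b). a \<in> A \<and> b \<in> B \<and> 0 < a \<and> 0 < b \<and> a * b \<le> nat \<lfloor>x\<rfloor>} \<rightarrow>
          {(D1, D2). P D1 D2 \<and> \<bar>real_of_int (D1 * D2)\<bar> \<le> x}"
      using le P by auto
    show "map_prod nat nat \<in> {(D1, D2). P D1 D2 \<and> \<bar>real_of_int (D1 * D2)\<bar> \<le> x} \<rightarrow>
          {(a, b). a \<in> A \<and> b \<in> B \<and> 0 < a \<and> 0 < b \<and> a * b \<le> nat \<lfloor>x\<rfloor>}"
    proof (rule Pi_I)
      fix d assume "d \<in> {(D1, D2). P D1 D2 \<and> \<bar>real_of_int (D1 * D2)\<bar> \<le> x}"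
      then obtain D1 D2 where d: "d = (D1, D2)" "P D1 D2" "\<bar>real_of_int (D1 * D2)\<bar> \<le> x" by auto
      from sub[OF d(2)] obtain m n where "D1 = int m" "D2 = int n"
        by (metis less_imp_le nonneg_int_cases)
      with d sub[OF d(2)] P le show "map_prod nat nat d \<in>
          {(a, b). a \<in> A \<and> b \<in> B \<and> 0 < a \<and> 0 < b \<and> a * b \<le> nat \<lfloor>x\<rfloor>}" by simp
    qed
  qed (use sub in fastforce)+
  then show ?thesis unfolding hyperbola_count_def by (rule bij_betw_same_card[symmetric])
qed

text \<open>The divisors 1 and \<open>q\<close> give \<open>a + b * q ^ r\<close> with
  \<open>a\<close> and \<open>b\<close> in \<open>{-1, 0, 1}\<close>. As \<open>q ^ r > 1\<close>,
  the second term dominates unless \<open>b = 0\<close>.\<close>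

lemma sgn_twisted_sigma_prime:
  assumes "prime q" "r \<ge> 1"
  shows "sgn (twisted_sigma r (quadratic_character D1) (quadratic_character D2) q) =
    (if kronecker D2 (int q) \<noteq> 0 then kronecker D2 (int q) else kronecker D1 (int q))"
proof -
  define a b where "a = kronecker D1 (int q)" and "b = kronecker D2 (int q)"
  have ab: "a \<in> {-1, 0, 1}" "b \<in> {-1, 0, 1}"
    unfolding a_def b_def kronecker_prime_arg[OF assms(1)] by (rule kronecker_prime_values)+
  have q: "q > 1" using assms(1) by (rule prime_gt_1_nat)
  have "{d. d dvd q} = {1, q}" using assms(1) by (auto simp: prime_nat_iff)
  then have eq: "twisted_sigma r (quadratic_character D1) (quadratic_character D2) q =
      real_of_int a + real_of_int b * real q ^ r"
    using q by (simp add: twisted_sigma_def quadratic_character_def a_def b_def)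
  have "real q ^ r > 1" using q assms(2) by (intro one_less_power) auto
  then show ?thesis unfolding eq a_def[symmetric] b_def[symmetric] using ab by (auto simp: sgn_if)
qed

lemma sum_local_weights:
  assumes "\<epsilon> \<in> {-1, 0, 1}"
  shows "(\<Sum>(a, b) | a \<in> {-1, 0, 1} \<and> b \<in> {-1, 0, 1} \<and> real_of_int (if b \<noteq> 0 then b else a) = \<epsilon>.
            local_weight q a * local_weight q b) =
         (if \<epsilon> = 0 then 1 / (real q + 1)\<^sup>2
          else real q * (real q + 2) / (2 * (real q + 1)\<^sup>2))"
proof -
  let ?J = "{(a, b). a \<in> {-1, 0, 1} \<and> b \<in> {-1, 0, 1} \<and> real_of_int (if b \<noteq> 0 then b else a) = \<epsilon>}"
  consider "\<epsilon> = 0" | e :: int where "e \<in> {-1, 1}" "\<epsilon> = real_of_int e"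
    using assms by (metis insert_iff of_int_1 of_int_minus singletonD)
  then show ?thesis
  proof cases
    case 1
    then have "?J = {(0, 0)}" by (auto split: if_splits)
    then show ?thesis using 1 by (simp add: local_weight_def power2_eq_square)
  next
    case 2
    then have J: "?J = {(-1, e), (0, e), (1, e), (e, 0)}" by (auto split: if_splits)
    \<comment> \<open>Used with \<open>y = q\<close> and \<open>t = q + 1\<close>: two of the four
      pairs have both values non-zero, and two have exactly one value 0.\<close>
    have eq: "2 * (y / (2 * t)) * (y / (2 * t)) + 2 * (1 / t) * (y / (2 * t)) = y * (y + 2) / (2 * t\<^sup>2)"
      if "t \<noteq> 0" for y t :: real
      using that by (simp add: field_simps power2_eq_square)
    have "real q + 1 \<noteq> 0" by linarith
    then show ?thesis using 2 eq[of "real q + 1" "real q"] unfolding J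
      by (auto simp: local_weight_def)
  qed
qed

theorem theorem4p3:
  fixes k l :: nat and p :: "nat \<Rightarrow> nat" and \<epsilon> :: "nat \<Rightarrow> real"
  assumes "k \<ge> 2"
    and "\<And>i. i \<in> {1..l} \<Longrightarrow> prime (p i)"
    and "inj_on p {1..l}"
    and "\<And>i. i \<in> {1..l} \<Longrightarrow> \<epsilon> i \<in> {-1, 0, 1}"
  shows "((\<lambda>x::real.
      real (card {(D1, D2) \<in> discriminant_pairs x.
               \<forall>i\<in>{1..l}.
                 sgn (twisted_sigma (k - 1) (quadratic_character D1) (quadratic_character D2) (p i))
                   = \<epsilon> i})
        / real (card (discriminant_pairs x)))
    \<longlongrightarrow> (\<Prod>i\<in>{i\<in>{1..l}. \<epsilon> i = 0}. 1 / (real (p i) + 1)\<^sup>2) *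
        (\<Prod>i\<in>{i\<in>{1..l}. \<epsilon> i \<noteq> 0}. real (p i) * (real (p i) + 2) / (2 * (real (p i) + 1)\<^sup>2)))
    at_top"
proof -
  define I where "I = {1..l}"
  have finI: "finite I" by (simp add: I_def)
  \<comment> \<open>The possible values of the two characters at \<open>p i\<close> that produce the
    sign \<open>\<epsilon> i\<close>. An element of \<open>G\<close> below selects one such pair for
    each index.\<close>
  define J where "J i = {(a, b). a \<in> {-1, 0, 1} \<and> b \<in> {-1, 0, 1} \<and>
    real_of_int (if b \<noteq> 0 then b else a) = \<epsilon> i}" for i
  have finJ: "finite (J i)" for i
    by (rule finite_subset[of _ "{-1, 0, 1} \<times> {-1, 0, 1}"]) (auto simp: J_def)
  define V where "V s = signed_discriminants I p s" for s
  \<comment> \<open>With no index to constrain, this is the set of all real quadratic discriminants;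
    the function \<open>\<lambda>_. 0\<close> is a dummy.\<close>
  define V0 where "V0 = signed_discriminants ({} :: nat set) p (\<lambda>_. 0)"
  define G where "G = (\<Pi>\<^sub>E i\<in>I. J i)"
  have finG: "finite G" unfolding G_def by (intro finite_PiE finI finJ)
  define M where "M x = {(D1, D2) \<in> discriminant_pairs x. \<forall>i\<in>I.
     sgn (twisted_sigma (k - 1) (quadratic_character D1) (quadratic_character D2) (p i)) = \<epsilon> i}" for x

  obtain c where c: "c > 0"
    "\<And>(I :: nat set) p s. finite I \<Longrightarrow> inj_on p I \<Longrightarrow> (\<And>i. i \<in> I \<Longrightarrow> prime (p i)) \<Longrightarrow>
       (\<And>i. i \<in> I \<Longrightarrow> s i \<in> {-1, 0, 1}) \<Longrightarrow>
       has_density (signed_discriminants I p s) (c * (\<Prod>i\<in>I. local_weight (p i) (s i)))"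
    using density_signed_discriminants by blast
  have V0: "has_density V0 c"
    using c(2)[of "{}"] by (simp add: V0_def)
  have V: "has_density (V s) (c * (\<Prod>i\<in>I. local_weight (p i) (s i)))"
    if "\<And>i. i \<in> I \<Longrightarrow> s i \<in> {-1, 0, 1}" for s
    unfolding V_def using assms(2,3) that by (intro c(2) finI) (auto simp: I_def)

  have card_all: "card (discriminant_pairs x) = hyperbola_count V0 V0 (nat \<lfloor>x\<rfloor>)" if "x \<ge> 0" for x
  proof -
    have "card {(D1, D2). (D1 \<in> real_quadratic_discriminants \<and> D2 \<in> real_quadratic_discriminants) \<and>
        \<bar>real_of_int (D1 * D2)\<bar> \<le> x} = hyperbola_count V0 V0 (nat \<lfloor>x\<rfloor>)"
      using that by (rule card_int_pairs_eq_hyperbola_count)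
        (auto simp: V0_def signed_discriminants_def real_quadratic_discriminants_def)
    then show ?thesis by (simp add: discriminant_pairs_def conj_assoc)
  qed

  \<comment> \<open>The pairs with symbol values prescribed by \<open>g\<close>. For fixed
    \<open>g\<close> the condition separates into one on \<open>D1\<close> and one on
    \<open>D2\<close>, which makes this a hyperbola count.\<close>
  define N where "N g x = {(D1, D2). (D1 \<in> real_quadratic_discriminants \<and> D2 \<in> real_quadratic_discriminants \<and>
      (\<forall>i\<in>I. kronecker D1 (int (p i)) = fst (g i) \<and> kronecker D2 (int (p i)) = snd (g i))) \<and>
      \<bar>real_of_int (D1 * D2)\<bar> \<le> x}" for g :: "nat \<Rightarrow> int \<times> int" and x
  have card_N: "card (N g x) = hyperbola_count (V (\<lambda>i. fst (g i))) (V (\<lambda>i. snd (g i))) (nat \<lfloor>x\<rfloor>)"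
    if "x \<ge> 0" for g x
    unfolding N_def using that by (rule card_int_pairs_eq_hyperbola_count)
      (auto simp: V_def signed_discriminants_def real_quadratic_discriminants_def)
  have N_sub: "N g x \<subseteq> discriminant_pairs x" for g x
    by (auto simp: N_def discriminant_pairs_def)
  have M_eq: "M x = (\<Union>g\<in>G. N g x)" for x
  proof (intro equalityI subsetI)
    fix d assume "d \<in> M x"
    then obtain D1 D2 where d: "d = (D1, D2)" "(D1, D2) \<in> discriminant_pairs x"
      "\<And>i. i \<in> I \<Longrightarrow> sgn (twisted_sigma (k - 1) (quadratic_character D1) (quadratic_character D2) (p i)) = \<epsilon> i"
      by (auto simp: M_def)
    define g where "g = (\<lambda>i\<in>I. (kronecker D1 (int (p i)), kronecker D2 (int (p i))))"
    have "g i \<in> J i" if "i \<in> I" for i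
    proof -
      have q: "prime (p i)" using that assms(2) by (simp add: I_def)
      show ?thesis using d(3)[OF that] sgn_twisted_sigma_prime[OF q, of "k - 1" D1 D2] assms(1) that
          kronecker_prime_values[of D1 "int (p i)"] kronecker_prime_values[of D2 "int (p i)"]
        by (auto simp: g_def J_def kronecker_prime_arg[OF q])
    qed
    then have "g \<in> G" by (auto simp: G_def g_def)
    moreover have "d \<in> N g x" using d(2) by (auto simp: d(1) N_def g_def discriminant_pairs_def)
    ultimately show "d \<in> (\<Union>g\<in>G. N g x)" by blast
  next
    fix d assume "d \<in> (\<Union>g\<in>G. N g x)"
    then obtain g D1 D2 where d: "g \<in> G" "d = (D1, D2)" "(D1, D2) \<in> N g x" by (cases d) auto
    have "sgn (twisted_sigma (k - 1) (quadratic_character D1) (quadratic_character D2) (p i)) = \<epsilon> i"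
      if "i \<in> I" for i
    proof -
      have q: "prime (p i)" using that assms(2) by (simp add: I_def)
      have "g i \<in> J i" using d(1) that by (auto simp: G_def)
      moreover have "g i = (kronecker D1 (int (p i)), kronecker D2 (int (p i)))"
        using d(3) that by (auto simp: N_def prod_eq_iff)
      ultimately show ?thesis
        using sgn_twisted_sigma_prime[OF q, of "k - 1" D1 D2] assms(1) by (simp add: J_def)
    qed
    then show "d \<in> M x" using d N_sub by (auto simp: M_def)
  qed
  have card_M: "card (M x) = (\<Sum>g\<in>G. card (N g x))" for x
    unfolding M_eq
  proof (rule card_UN_disjoint[OF finG])
    show "\<forall>g\<in>G. finite (N g x)"
      using finite_subset[OF N_sub finite_discriminant_pairs] by blast
    \<comment> \<open>A pair determines its symbol values, and two different members of
      \<open>G\<close> differ at some index in \<open>I\<close> by extensionality.\<close>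
    show "\<forall>g\<in>G. \<forall>h\<in>G. g \<noteq> h \<longrightarrow> N g x \<inter> N h x = {}"
    proof (intro ballI impI)
      fix g h assume gh: "g \<in> G" "h \<in> G" "g \<noteq> h"
      then obtain i where "i \<in> I" "g i \<noteq> h i" unfolding G_def by (meson PiE_ext)
      then show "N g x \<inter> N h x = {}" by (auto simp: N_def prod_eq_iff)
    qed
  qed

  let ?H = "\<lambda>n. real (hyperbola_count UNIV UNIV n)"
  let ?S = "\<lambda>n. \<Sum>g\<in>G. real (hyperbola_count (V (\<lambda>i. fst (g i))) (V (\<lambda>i. snd (g i))) n)"
  let ?W = "\<Prod>i\<in>I. \<Sum>(a, b)\<in>J i. local_weight (p i) a * local_weight (p i) b"
  have "(\<lambda>n. \<Sum>g\<in>G. real (hyperbola_count (V (\<lambda>i. fst (g i))) (V (\<lambda>i. snd (g i))) n) / ?H n)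
      \<longlonglongrightarrow> (\<Sum>g\<in>G. (c * (\<Prod>i\<in>I. local_weight (p i) (fst (g i)))) * (c * (\<Prod>i\<in>I. local_weight (p i) (snd (g i)))))"
  proof (intro tendsto_sum hyperbola_count_asymp V)
    fix g i assume "g \<in> G" "i \<in> I"
    then have "g i \<in> J i" by (auto simp: G_def)
    then show "fst (g i) \<in> {-1, 0, 1}" "snd (g i) \<in> {-1, 0, 1}" by (auto simp: J_def)
  qed
  also have "(\<Sum>g\<in>G. (c * (\<Prod>i\<in>I. local_weight (p i) (fst (g i)))) * (c * (\<Prod>i\<in>I. local_weight (p i) (snd (g i))))) =
      c * c * (\<Sum>g\<in>G. \<Prod>i\<in>I. local_weight (p i) (fst (g i)) * local_weight (p i) (snd (g i)))"
    by (simp add: prod.distrib sum_distrib_left mult_ac)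
  \<comment> \<open>Distributivity: the sum over all patterns of a product over the primes is the
    product of the local sums.\<close>
  also have "(\<Sum>g\<in>G. \<Prod>i\<in>I. local_weight (p i) (fst (g i)) * local_weight (p i) (snd (g i))) = ?W"
    unfolding G_def using prod_sum_PiE[OF finI finJ, of "\<lambda>i ab. local_weight (p i) (fst ab) * local_weight (p i) (snd ab)"]
    by (simp add: case_prod_unfold)
  finally have "(\<lambda>n. ?S n / ?H n) \<longlonglongrightarrow> c * c * ?W" by (simp add: sum_divide_distrib)
  then have "(\<lambda>n. (?S n / ?H n) / (real (hyperbola_count V0 V0 n) / ?H n)) \<longlonglongrightarrow> (c * c * ?W) / (c * c)"
    using c(1) by (intro tendsto_divide hyperbola_count_asymp V0) auto
  also have "(c * c * ?W) / (c * c) = ?W" using c(1) by simp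
  finally have "(\<lambda>n. (?S n / ?H n) / (real (hyperbola_count V0 V0 n) / ?H n)) \<longlonglongrightarrow> ?W" .
  \<comment> \<open>The full count may be cancelled because it is eventually non-zero, by its
    superlinear growth.\<close>
  moreover have "\<forall>\<^sub>F n in sequentially. (?S n / ?H n) / (real (hyperbola_count V0 V0 n) / ?H n) =
      ?S n / real (hyperbola_count V0 V0 n)"
    using hyperbola_count_superlinear[unfolded filterlim_at_top_dense, rule_format, of 0]
    by eventually_elim auto
  ultimately have "(\<lambda>n. ?S n / real (hyperbola_count V0 V0 n)) \<longlonglongrightarrow> ?W"
    by (rule Lim_transform_eventually)
  \<comment> \<open>Passage from integer bounds to real \<open>x\<close>: both counts depend only on
    the integer part of \<open>x\<close>, which tends to infinity.\<close>
  then have "((\<lambda>x::real. ?S (nat \<lfloor>x\<rfloor>) / real (hyperbola_count V0 V0 (nat \<lfloor>x\<rfloor>))) \<longlongrightarrow> ?W) at_top"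
    by (rule filterlim_compose) (intro filterlim_compose[OF filterlim_nat_sequentially filterlim_floor_sequentially])
  moreover have "\<forall>\<^sub>F x::real in at_top. ?S (nat \<lfloor>x\<rfloor>) / real (hyperbola_count V0 V0 (nat \<lfloor>x\<rfloor>)) =
      real (card (M x)) / real (card (discriminant_pairs x))"
    using eventually_ge_at_top[of 0] by eventually_elim (simp add: card_M card_N card_all)
  ultimately have "((\<lambda>x. real (card (M x)) / real (card (discriminant_pairs x))) \<longlongrightarrow> ?W) at_top"
    by (rule Lim_transform_eventually)
  also have "?W = (\<Prod>i\<in>I. if \<epsilon> i = 0 then 1 / (real (p i) + 1)\<^sup>2
      else real (p i) * (real (p i) + 2) / (2 * (real (p i) + 1)\<^sup>2))"
    unfolding J_def using assms(4) by (intro prod.cong sum_local_weights) (auto simp: I_def)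
  also have "\<dots> = (\<Prod>i\<in>{i\<in>I. \<epsilon> i = 0}. 1 / (real (p i) + 1)\<^sup>2) *
      (\<Prod>i\<in>{i\<in>I. \<epsilon> i \<noteq> 0}. real (p i) * (real (p i) + 2) / (2 * (real (p i) + 1)\<^sup>2))"
    using finI by (simp add: prod.If_cases Int_def Collect_neg_eq[symmetric])
  finally show ?thesis unfolding M_def I_def .
qed

end
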